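(* Let $A$ be a unital associative algebra over $\mathbb K$ and let $G$ be the group (under convolution $*$) of characters of $\overline T(T(A))$. For $\Psi\in G$ and $L\in\operatorname{End}(\overline T(A))$ (linear endomorphisms of $\overline T(A)$), set $$L.\Psi \coloneqq (L\otimes\Psi)\Delta\big|_{\overline T(A)},$$ where $\Delta$ restricted to $\overline T(A)$ takes values in $\overline T(A)\otimes\overline T(T(A))$. Then $L.\Psi\in \operatorname{End}(\overline T(A))$ and $(\Psi,L)\mapsto L.\Psi$ defines a right action of $G$ on $\operatorname{End}(\overline T(A))$.
   Context: $\mathbb K$ is a field of characteristic zero. $T(A)=\bigoplus_{n\ge1}A^{\otimes n}$, whose elements are written as words $a_1\cdots a_n=a_1\otimes\cdots\otimes a_n$; $\overline T(A)=\mathbb K\mathbf 1\oplus T(A)$ with $\mathbf 1$ the empty word. The double tensor algebra is $\overline T(T(A))=\mathbb K\mathbf 1\oplus\bigoplus_{k\ge1}T(A)^{\otimes k}$; its concatenation product is denoted by a vertical bar, $w_1|w_2$, and its unit $\mathbf 1$ is identified with the empty word, so that $\overline T(A)\subset\overline T(T(A))$. For $S=\{s_1<\dots<s_p\}\subseteq[n]=\{1,\dots,n\}$ put $a_S=a_{s_1}\cdots a_{s_p}$, $a_\emptyset=\mathbf 1$; $J^S_1,\dots,J^S_k$ denote the connected components of $[n]\setminus S$ (maximal sets of consecutive integers contained in $[n]\setminus S$), ordered increasingly by minimal element. The coproduct is given on words by $$\Delta(a_1\cdots a_n)=\sum_{S\subseteq[n]}a_S\otimes a_{J^S_1}|\cdots|a_{J^S_k}$$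 (the second factor being $\mathbf 1$ when $S=[n]$), with $\Delta(\mathbf 1)=\mathbf 1\otimes\mathbf 1$, extended multiplicatively to $\Delta:\overline T(T(A))\to\overline T(T(A))\otimes\overline T(T(A))$; this makes $\overline T(T(A))$ a connected graded Hopf algebra. Convolution of linear forms is $f*g=(f\otimes g)\Delta$; its unit is the counit $\varepsilon$, with $\varepsilon(\mathbf 1)=1$ and $\varepsilon$ vanishing on $T(T(A))$. A character is a unital multiplicative linear map $\overline T(T(A))\to\mathbb K$. We identify $V\otimes\mathbb K$ with $V$. *)

theory Defs
  imports Complex_Main "HOL-Algebra.Module" "HOL-Library.Poly_Mapping"
begin

text \<open>The ground field is a type \<open>'k\<close>; vector spaces over it are \<open>HOL-Algebra\<close> modules over the
  record \<open>\<bbbK>\<close>. The fields \<open>mult\<close> and \<open>one\<close> of a module record are irrelevant when it is only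
  used as a vector space.\<close>

definition ground :: "('k::field, 'k) module" (\<open>\<bbbK>\<close>) where
  "\<bbbK> = \<lparr>carrier = UNIV, mult = (*), one = 1, zero = 0, add = (+), smult = (*)\<rparr>"

text \<open>\<open>HOL-Algebra\<close>'s locale \<open>algebra\<close> is restricted to commutative algebras.\<close>

definition unital_assoc_algebra :: "('k::field, 'a) module \<Rightarrow> bool" where
  "unital_assoc_algebra A \<longleftrightarrow> module \<bbbK> A \<and> ring A \<and>
     (\<forall>c. \<forall>x\<in>carrier A. \<forall>y\<in>carrier A.
        (c \<odot>\<^bsub>A\<^esub> x) \<otimes>\<^bsub>A\<^esub> y = c \<odot>\<^bsub>A\<^esub> (x \<otimes>\<^bsub>A\<^esub> y) \<and>
        x \<otimes>\<^bsub>A\<^esub> (c \<odot>\<^bsub>A\<^esub> y) = c \<odot>\<^bsub>A\<^esub> (x \<otimes>\<^bsub>A\<^esub> y))"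

text \<open>Linear maps are extensional, i.e.\ have the value \<open>undefined\<close> off the carrier of their domain,
  so that equality of linear maps is equality of functions.\<close>

definition Lin :: "('k::field, 'v) module \<Rightarrow> ('k, 'w) module \<Rightarrow> ('v \<Rightarrow> 'w) set" where
  "Lin V W = {f \<in> carrier V \<rightarrow>\<^sub>E carrier W.
     (\<forall>x\<in>carrier V. \<forall>y\<in>carrier V. f (x \<oplus>\<^bsub>V\<^esub> y) = f x \<oplus>\<^bsub>W\<^esub> f y) \<and>
     (\<forall>c. \<forall>x\<in>carrier V. f (c \<odot>\<^bsub>V\<^esub> x) = c \<odot>\<^bsub>W\<^esub> f x)}"


section \<open>Algebras given by generators and relations\<close>

definition scale_pm :: "'k::field \<Rightarrow> ('x \<Rightarrow>\<^sub>0 'k) \<Rightarrow> ('x \<Rightarrow>\<^sub>0 'k)" where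
  "scale_pm c p = Poly_Mapping.map ((*) c) p"

lemma lookup_scale_pm: "Poly_Mapping.lookup (scale_pm c p) x = c * Poly_Mapping.lookup p x"
  by (simp add: scale_pm_def Poly_Mapping.map.rep_eq when_def)

global_interpretation pm: vector_space scale_pm
  defines span_pm = pm.span
  by standard (auto intro!: poly_mapping_eqI simp: lookup_scale_pm lookup_add algebra_simps)

definition mult_pm :: "('x, 'm) monoid_scheme \<Rightarrow> ('x \<Rightarrow>\<^sub>0 'k::field) \<Rightarrow> ('x \<Rightarrow>\<^sub>0 'k) \<Rightarrow> ('x \<Rightarrow>\<^sub>0 'k)" where
  "mult_pm M p q = (\<Sum>x\<in>Poly_Mapping.keys p. \<Sum>y\<in>Poly_Mapping.keys q.
     Poly_Mapping.single (x \<otimes>\<^bsub>M\<^esub> y) (Poly_Mapping.lookup p x * Poly_Mapping.lookup q y))"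

definition cls :: "('x \<Rightarrow>\<^sub>0 'k::field) set \<Rightarrow> ('x \<Rightarrow>\<^sub>0 'k) \<Rightarrow> ('x \<Rightarrow>\<^sub>0 'k) set" where
  "cls R p = {q. q - p \<in> span_pm R}"

text \<open>The quotient of the monoid algebra \<open>\<bbbK>[M]\<close> by the linear span of \<open>R\<close>. It is only used for sets
  \<open>R\<close> whose span is a two-sided ideal; the unions below are then unions over a single class.\<close>

definition presented :: "('x, 'm) monoid_scheme \<Rightarrow> ('x \<Rightarrow>\<^sub>0 'k::field) set
    \<Rightarrow> ('k, ('x \<Rightarrow>\<^sub>0 'k) set) module" where
  "presented M R =
     \<lparr>carrier = {cls R p |p. Poly_Mapping.keys p \<subseteq> carrier M},
      mult = (\<lambda>X Y. \<Union>p\<in>X. \<Union>q\<in>Y. cls R (mult_pm M p q)),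
      one = cls R (Poly_Mapping.single \<one>\<^bsub>M\<^esub> 1),
      zero = cls R 0,
      add = (\<lambda>X Y. \<Union>p\<in>X. \<Union>q\<in>Y. cls R (p + q)),
      smult = (\<lambda>c X. \<Union>p\<in>X. cls R (scale_pm c p))\<rparr>"

text \<open>The linear map into \<open>W\<close> sending the class of a generator \<open>x\<close> to \<open>f x\<close>. The result does not
  depend on the chosen representative whenever the linear extension of \<open>f\<close> kills the relations.\<close>

definition lin_ext :: "('k::field, 'w) module \<Rightarrow> ('x \<Rightarrow> 'w) \<Rightarrow> ('x \<Rightarrow>\<^sub>0 'k) set \<Rightarrow> 'w" where
  "lin_ext W f X = (let p = (SOME p. p \<in> X) in
     \<Oplus>\<^bsub>W\<^esub>x\<in>Poly_Mapping.keys p. Poly_Mapping.lookup p x \<odot>\<^bsub>W\<^esub> f x)"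


section \<open>Tensor algebras\<close>

definition word_monoid :: "('k::field, 'v) module \<Rightarrow> 'v list monoid" where
  "word_monoid V = \<lparr>carrier = lists (carrier V), mult = (@), one = []\<rparr>"

definition multilinear_rels :: "('k::field, 'v) module \<Rightarrow> ('v list \<Rightarrow>\<^sub>0 'k) set" where
  "multilinear_rels V =
     {Poly_Mapping.single (u @ [x \<oplus>\<^bsub>V\<^esub> y] @ v) 1
        - Poly_Mapping.single (u @ [x] @ v) 1 - Poly_Mapping.single (u @ [y] @ v) 1 |u x y v.
        u \<in> lists (carrier V) \<and> v \<in> lists (carrier V) \<and> x \<in> carrier V \<and> y \<in> carrier V} \<union>
     {Poly_Mapping.single (u @ [c \<odot>\<^bsub>V\<^esub> x] @ v) 1 - Poly_Mapping.single (u @ [x] @ v) c |u c x v.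
        u \<in> lists (carrier V) \<and> v \<in> lists (carrier V) \<and> x \<in> carrier V}"

text \<open>\<open>Tbar V\<close> is the direct sum of all \<open>V\<^sup>\<otimes>\<^sup>n\<close>, \<open>n \<ge> 0\<close>, with the concatenation product: no relation
  mixes words of different lengths.\<close>

definition Tbar :: "('k::field, 'v) module \<Rightarrow> ('k, ('v list \<Rightarrow>\<^sub>0 'k) set) module" where
  "Tbar V = presented (word_monoid V) (multilinear_rels V)"

definition word :: "('k::field, 'v) module \<Rightarrow> 'v list \<Rightarrow> ('v list \<Rightarrow>\<^sub>0 'k) set" where
  "word V w = cls (multilinear_rels V) (Poly_Mapping.single w 1)"

text \<open>The subspace of \<open>Tbar V\<close> formed by the degrees \<open>n \<ge> 1\<close>.\<close>

definition Tplus :: "('k::field, 'v) module \<Rightarrow> ('k, ('v list \<Rightarrow>\<^sub>0 'k) set) module" where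
  "Tplus V = (Tbar V)\<lparr>carrier := {cls (multilinear_rels V) p |p.
     Poly_Mapping.keys p \<subseteq> lists (carrier V) - {[]}}\<rparr>"


section \<open>Tensor products of two algebras\<close>

definition bilinear_rels ::
    "('k::field, 'v) module \<Rightarrow> ('k, 'w) module \<Rightarrow> ('v \<times> 'w \<Rightarrow>\<^sub>0 'k) set" where
  "bilinear_rels V W =
     {Poly_Mapping.single (x \<oplus>\<^bsub>V\<^esub> x', y) 1
        - Poly_Mapping.single (x, y) 1 - Poly_Mapping.single (x', y) 1 |x x' y.
        x \<in> carrier V \<and> x' \<in> carrier V \<and> y \<in> carrier W} \<union>
     {Poly_Mapping.single (x, y \<oplus>\<^bsub>W\<^esub> y') 1
        - Poly_Mapping.single (x, y) 1 - Poly_Mapping.single (x, y') 1 |x y y'.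
        x \<in> carrier V \<and> y \<in> carrier W \<and> y' \<in> carrier W} \<union>
     {Poly_Mapping.single (c \<odot>\<^bsub>V\<^esub> x, y) 1 - Poly_Mapping.single (x, y) c |c x y.
        x \<in> carrier V \<and> y \<in> carrier W} \<union>
     {Poly_Mapping.single (x, c \<odot>\<^bsub>W\<^esub> y) 1 - Poly_Mapping.single (x, y) c |c x y.
        x \<in> carrier V \<and> y \<in> carrier W}"

definition tensor :: "('k::field, 'v) module \<Rightarrow> ('k, 'w) module
    \<Rightarrow> ('k, ('v \<times> 'w \<Rightarrow>\<^sub>0 'k) set) module" where
  "tensor V W = presented (V \<times>\<times> W) (bilinear_rels V W)"

definition pure :: "('k::field, 'v) module \<Rightarrow> ('k, 'w) module \<Rightarrow> 'v \<Rightarrow> 'w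
    \<Rightarrow> ('v \<times> 'w \<Rightarrow>\<^sub>0 'k) set" where
  "pure V W x y = cls (bilinear_rels V W) (Poly_Mapping.single (x, y) 1)"

text \<open>\<open>f \<otimes> g\<close> for linear maps \<open>f\<close>, \<open>g\<close> with codomains \<open>V'\<close>, \<open>W'\<close>.\<close>

definition tensor_map :: "('k::field, 'v') module \<Rightarrow> ('k, 'w') module \<Rightarrow> ('v \<Rightarrow> 'v') \<Rightarrow> ('w \<Rightarrow> 'w')
    \<Rightarrow> ('v \<times> 'w \<Rightarrow>\<^sub>0 'k) set \<Rightarrow> ('v' \<times> 'w' \<Rightarrow>\<^sub>0 'k) set" where
  "tensor_map V' W' f g = lin_ext (tensor V' W') (\<lambda>(x, y). pure V' W' (f x) (g y))"

text \<open>The identification of \<open>V \<otimes> \<bbbK>\<close> with \<open>V\<close>.\<close>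

definition tensor_ground :: "('k::field, 'v) module \<Rightarrow> ('v \<times> 'k \<Rightarrow>\<^sub>0 'k) set \<Rightarrow> 'v" where
  "tensor_ground V = lin_ext V (\<lambda>(x, c). c \<odot>\<^bsub>V\<^esub> x)"


section \<open>The double tensor algebra\<close>

type_synonym ('k, 'a) tens = "('a list \<Rightarrow>\<^sub>0 'k) set"
type_synonym ('k, 'a) dtens = "('k, ('k, 'a) tens) tens"

abbreviation TT :: "('k::field, 'a) module \<Rightarrow> ('k, ('k, 'a) dtens) module" where
  "TT A \<equiv> Tbar (Tplus A)"

text \<open>The image \<open>a\<^sub>1\<cdots>a\<^sub>n\<close> in the double tensor algebra of a word in \<open>A\<close>, the empty word being sent
  to the unit, and the resulting inclusion of \<open>Tbar A\<close> into \<open>TT A\<close>.\<close>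

definition incl_word :: "('k::field, 'a) module \<Rightarrow> 'a list \<Rightarrow> ('k, 'a) dtens" where
  "incl_word A w = (if w = [] then \<one>\<^bsub>TT A\<^esub> else word (Tplus A) [word A w])"

definition incl :: "('k::field, 'a) module \<Rightarrow> ('k, 'a) tens \<Rightarrow> ('k, 'a) dtens" where
  "incl A = lin_ext (TT A) (incl_word A)"

text \<open>The maximal sets of consecutive integers contained in \<open>U\<close>, listed by increasing minimum.\<close>

definition components :: "nat set \<Rightarrow> nat set set" where
  "components U = {J. (\<exists>l u. l \<le> u \<and> J = {l..u}) \<and> J \<subseteq> U \<and>
     (\<forall>l u. J \<subseteq> {l..u} \<and> {l..u} \<subseteq> U \<longrightarrow> {l..u} = J)}"

definition component_list :: "nat set \<Rightarrow> nat set list" where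
  "component_list U = sorted_key_list_of_set Min (components U)"

text \<open>\<open>nths w S\<close> is the subword \<open>a\<^sub>S\<close>; positions in a word are counted from \<open>0\<close>.\<close>

definition coprod_word ::
    "('k::field, 'a) module \<Rightarrow> 'a list \<Rightarrow> (('k, 'a) dtens \<times> ('k, 'a) dtens \<Rightarrow>\<^sub>0 'k) set" where
  "coprod_word A w = (\<Oplus>\<^bsub>tensor (TT A) (TT A)\<^esub>S\<in>Pow {..<length w}.
     pure (TT A) (TT A) (incl_word A (nths w S))
       (word (Tplus A) (map (\<lambda>J. word A (nths w J)) (component_list ({..<length w} - S)))))"

text \<open>The linear and multiplicative extension to the double tensor algebra.\<close>

definition coprod ::
    "('k::field, 'a) module \<Rightarrow> ('k, 'a) dtens \<Rightarrow> (('k, 'a) dtens \<times> ('k, 'a) dtens \<Rightarrow>\<^sub>0 'k) set" where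
  "coprod A = lin_ext (tensor (TT A) (TT A))
     (\<lambda>ts. foldr (\<lambda>t z. lin_ext (tensor (TT A) (TT A)) (coprod_word A) t \<otimes>\<^bsub>tensor (TT A) (TT A)\<^esub> z)
        ts \<one>\<^bsub>tensor (TT A) (TT A)\<^esub>)"

text \<open>The coproduct of \<open>x \<in> Tbar A\<close>, regarded as an element of \<open>Tbar A \<otimes> TT A\<close> via the injection
  \<open>incl \<otimes> id\<close> of \<open>Tbar A \<otimes> TT A\<close> into \<open>TT A \<otimes> TT A\<close>.\<close>

abbreviation incl_tensor_id :: "('k::field, 'a) module
    \<Rightarrow> (('k, 'a) tens \<times> ('k, 'a) dtens \<Rightarrow>\<^sub>0 'k) set
    \<Rightarrow> (('k, 'a) dtens \<times> ('k, 'a) dtens \<Rightarrow>\<^sub>0 'k) set" where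
  "incl_tensor_id A \<equiv> tensor_map (TT A) (TT A) (incl A) id"

definition coprod_restr ::
    "('k::field, 'a) module \<Rightarrow> ('k, 'a) tens \<Rightarrow> (('k, 'a) tens \<times> ('k, 'a) dtens \<Rightarrow>\<^sub>0 'k) set" where
  "coprod_restr A x =
     (THE z. z \<in> carrier (tensor (Tbar A) (TT A)) \<and> incl_tensor_id A z = coprod A (incl A x))"


section \<open>Characters and their action\<close>

definition characters :: "('k::field, 'a) module \<Rightarrow> (('k, 'a) dtens \<Rightarrow> 'k) set" where
  "characters A = Lin (TT A) \<bbbK> \<inter> ring_hom (TT A) \<bbbK>"

definition convolution :: "('k::field, 'a) module \<Rightarrow> (('k, 'a) dtens \<Rightarrow> 'k)
    \<Rightarrow> (('k, 'a) dtens \<Rightarrow> 'k) \<Rightarrow> ('k, 'a) dtens \<Rightarrow> 'k" where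
  "convolution A f g =
     (\<lambda>x\<in>carrier (TT A). tensor_ground \<bbbK> (tensor_map \<bbbK> \<bbbK> f g (coprod A x)))"

definition counit :: "('k::field, 'a) module \<Rightarrow> ('k, 'a) dtens \<Rightarrow> 'k" where
  "counit A = (\<lambda>x\<in>carrier (TT A). lin_ext \<bbbK> (\<lambda>ts. if ts = [] then 1 else 0) x)"

definition character_group :: "('k::field, 'a) module \<Rightarrow> (('k, 'a) dtens \<Rightarrow> 'k) monoid" where
  "character_group A = \<lparr>carrier = characters A, mult = convolution A, one = counit A\<rparr>"

definition char_act :: "('k::field, 'a) module \<Rightarrow> (('k, 'a) tens \<Rightarrow> ('k, 'a) tens)
    \<Rightarrow> (('k, 'a) dtens \<Rightarrow> 'k) \<Rightarrow> ('k, 'a) tens \<Rightarrow> ('k, 'a) tens" where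
  "char_act A L \<Psi> = (\<lambda>x\<in>carrier (Tbar A).
     tensor_ground (Tbar A) (tensor_map (Tbar A) \<bbbK> L \<Psi> (coprod_restr A x)))"

definition right_action :: "('g, 'm) monoid_scheme \<Rightarrow> 'e set \<Rightarrow> ('e \<Rightarrow> 'g \<Rightarrow> 'e) \<Rightarrow> bool" where
  "right_action G E act \<longleftrightarrow> group G \<and>
     (\<forall>x\<in>E. \<forall>g\<in>carrier G. act x g \<in> E) \<and>
     (\<forall>x\<in>E. act x \<one>\<^bsub>G\<^esub> = x) \<and>
     (\<forall>x\<in>E. \<forall>g\<in>carrier G. \<forall>h\<in>carrier G. act (act x g) h = act x (g \<otimes>\<^bsub>G\<^esub> h))"

end

theory Submission
  imports Defs
begin

text \<open>
  Linear maps on \<open>Tbar A\<close> and characters of \<open>TT A\<close> are determined by their values on words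
  \<open>w = a\<^sub>1\<cdots>a\<^sub>n\<close> (\<open>Lin_Tbar_eqI\<close>, \<open>character_eqI\<close>), and a character turns the bar product of the
  components into a product of scalars. On words, therefore,
  \<open>(L.\<Psi>)(w) = \<Sum>\<^sub>S (\<Prod>\<^sub>J \<psi>(a\<^sub>J)) L(a\<^sub>S)\<close>, where \<open>J\<close> runs over the components of \<open>[n] \<setminus> S\<close> and \<open>\<psi>\<close> is the
  restriction of \<open>\<Psi>\<close> to words. The right-hand side, called \<open>gapsum\<close> below, makes sense for any
  function \<open>\<psi>\<close> on words with \<open>\<psi>(\<one>) = 1\<close> and any function \<open>L\<close> on words with values in a vector space.
  When \<open>L\<close> is scalar valued it computes the convolution product. Associativity of the convolution
  and the action law \<open>(L.\<Psi>).\<Phi> = L.(\<Psi> * \<Phi>)\<close> are thus two instances of one identity,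
  \<open>gapsum_gapsum\<close>.

  That identity says that two substitutions compose. Dually, \<open>L \<mapsto> L.\<psi>\<close> replaces a word
  \<open>b\<^sub>1\<cdots>b\<^sub>k\<close> by the noncommutative series \<open>\<psi> b\<^sub>1 \<psi> b\<^sub>2 \<cdots> b\<^sub>k \<psi>\<close>, and a substitution of this kind is
  compatible with cutting a word at one of its letters (\<open>gapsum_cut\<close>). Cutting \<open>L.\<psi>\<close> at the last letter
  of \<open>a\<^sub>S\<close> (\<open>gapsum_expand\<close>) writes it in terms of similar sums over shorter words, and the identity
  follows by induction on the length.

  The counit is the neutral element because \<open>\<psi> = \<epsilon>\<close> leaves only the term \<open>S = [n]\<close>, and \<open>L = \<epsilon>\<close> only
  the term \<open>S = \<emptyset>\<close>. In \<open>(\<phi> * \<psi>)(w)\<close> the term \<open>S = [n]\<close> is \<open>\<phi>(w)\<close>, while all others evaluate \<open>\<phi>\<close> at shorter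
  words; so \<open>\<phi> * \<psi> = \<epsilon>\<close> has a solution \<open>\<phi>\<close>, defined by recursion on the length
  (\<open>gap_inverse\<close>). It is multilinear, hence the restriction of a character, and left inverses
  suffice for a group.

  The remaining work makes the evaluation on words legitimate. Multilinear functions on words extend
  to the tensor algebra (\<open>lin_ext_Tbar\<close>). Each position of a word lies either in \<open>S\<close> or in exactly one
  component of the complement, so every term of the coproduct is multilinear (\<open>multilin_split\<close>) and
  the coproduct is well defined. Finally, the inclusion of \<open>Tbar A\<close> into \<open>TT A\<close> has a linear left
  inverse, so \<open>incl \<otimes> id\<close> is injective and the restricted coproduct is well defined as well.
\<close>

section \<open>Vector spaces and linear maps\<close>

lemma ground_simps [simp]:
  "carrier \<bbbK> = UNIV" "(\<otimes>\<^bsub>\<bbbK>\<^esub>) = (*)" "\<one>\<^bsub>\<bbbK>\<^esub> = 1" "\<zero>\<^bsub>\<bbbK>\<^esub> = 0" "(\<oplus>\<^bsub>\<bbbK>\<^esub>) = (+)" "(\<odot>\<^bsub>\<bbbK>\<^esub>) = (*)"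
  by (simp_all add: ground_def)

lemma cring_ground: "cring (\<bbbK> :: ('k::field, 'k) module)"
proof (rule cringI)
  show "abelian_group (\<bbbK> :: ('k, 'k) module)"
  proof (rule abelian_groupI)
    show "\<exists>y\<in>carrier \<bbbK>. y \<oplus>\<^bsub>\<bbbK>\<^esub> x = \<zero>\<^bsub>\<bbbK>\<^esub>" for x :: 'k
      by (rule bexI [of _ "- x"]) auto
  qed auto
  show "comm_monoid (\<bbbK> :: ('k, 'k) module)"
    by (rule comm_monoidI) auto
qed (auto simp: algebra_simps)

locale kspace =
  fixes W :: "('k::field, 'w) module" (structure)
  assumes module_axiom: "module \<bbbK> W"

sublocale kspace \<subseteq> module \<bbbK> W
  by (rule module_axiom)

context kspace
begin

lemma smult_in [simp, intro]: "x \<in> carrier W \<Longrightarrow> c \<odot> x \<in> carrier W"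
  by simp

lemma smult_add_left: "x \<in> carrier W \<Longrightarrow> (a + b) \<odot> x = a \<odot> x \<oplus> b \<odot> x"
  using smult_l_distr [of a b x] by simp

lemma smult_smult: "x \<in> carrier W \<Longrightarrow> a \<odot> (b \<odot> x) = (a * b) \<odot> x"
  using smult_assoc1 [of a b x] by simp

lemma smult_add_right: "x \<in> carrier W \<Longrightarrow> y \<in> carrier W \<Longrightarrow> a \<odot> (x \<oplus> y) = a \<odot> x \<oplus> a \<odot> y"
  using smult_r_distr [of a x y] by simp

lemma smult_1 [simp]: "x \<in> carrier W \<Longrightarrow> 1 \<odot> x = x"
  using smult_one [of x] by simp

lemma smult_0 [simp]: "x \<in> carrier W \<Longrightarrow> 0 \<odot> x = \<zero>"
  using smult_l_null [of x] by simp

lemma smult_zero [simp]: "c \<odot> \<zero> = \<zero>"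
  using smult_r_null [of c] by simp

lemma finsum_smult: "finite I \<Longrightarrow> (\<And>i. i \<in> I \<Longrightarrow> f i \<in> carrier W) \<Longrightarrow>
    c \<odot> (\<Oplus>i\<in>I. f i) = (\<Oplus>i\<in>I. c \<odot> f i)"
  using finsum_smult_ldistr [of I c f] by auto

end

lemma kspaceI:
  assumes "\<And>x y. x \<in> carrier W \<Longrightarrow> y \<in> carrier W \<Longrightarrow> x \<oplus>\<^bsub>W\<^esub> y \<in> carrier W"
    and "\<zero>\<^bsub>W\<^esub> \<in> carrier W"
    and "\<And>c x. x \<in> carrier W \<Longrightarrow> c \<odot>\<^bsub>W\<^esub> x \<in> carrier W"
    and "\<And>x y z. x \<in> carrier W \<Longrightarrow> y \<in> carrier W \<Longrightarrow> z \<in> carrier W \<Longrightarrow>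
      (x \<oplus>\<^bsub>W\<^esub> y) \<oplus>\<^bsub>W\<^esub> z = x \<oplus>\<^bsub>W\<^esub> (y \<oplus>\<^bsub>W\<^esub> z)"
    and "\<And>x y. x \<in> carrier W \<Longrightarrow> y \<in> carrier W \<Longrightarrow> x \<oplus>\<^bsub>W\<^esub> y = y \<oplus>\<^bsub>W\<^esub> x"
    and "\<And>x. x \<in> carrier W \<Longrightarrow> \<zero>\<^bsub>W\<^esub> \<oplus>\<^bsub>W\<^esub> x = x"
    and "\<And>x. x \<in> carrier W \<Longrightarrow> (-1) \<odot>\<^bsub>W\<^esub> x \<oplus>\<^bsub>W\<^esub> x = \<zero>\<^bsub>W\<^esub>"
    and "\<And>a b x. x \<in> carrier W \<Longrightarrow> (a + b) \<odot>\<^bsub>W\<^esub> x = a \<odot>\<^bsub>W\<^esub> x \<oplus>\<^bsub>W\<^esub> b \<odot>\<^bsub>W\<^esub> x"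
    and "\<And>a x y. x \<in> carrier W \<Longrightarrow> y \<in> carrier W \<Longrightarrow>
      a \<odot>\<^bsub>W\<^esub> (x \<oplus>\<^bsub>W\<^esub> y) = a \<odot>\<^bsub>W\<^esub> x \<oplus>\<^bsub>W\<^esub> a \<odot>\<^bsub>W\<^esub> y"
    and "\<And>a b x. x \<in> carrier W \<Longrightarrow> (a * b) \<odot>\<^bsub>W\<^esub> x = a \<odot>\<^bsub>W\<^esub> (b \<odot>\<^bsub>W\<^esub> x)"
    and "\<And>x. x \<in> carrier W \<Longrightarrow> 1 \<odot>\<^bsub>W\<^esub> x = x"
  shows "kspace (W :: ('k::field, 'w) module)"
proof (rule kspace.intro)
  have "abelian_group W"
  proof (rule abelian_groupI)
    show "\<exists>y\<in>carrier W. y \<oplus>\<^bsub>W\<^esub> x = \<zero>\<^bsub>W\<^esub>" if "x \<in> carrier W" for x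
      using assms(3,7) that by blast
  qed (use assms in auto)
  then show "module \<bbbK> W"
    by (intro moduleI) (use assms cring_ground in auto)
qed

lemma kspace_ground: "kspace (\<bbbK> :: ('k::field, 'k) module)"
  by (rule kspaceI) (auto simp: algebra_simps)

lemma finsum_ground: "finite I \<Longrightarrow> finsum \<bbbK> f I = sum f I" for f :: "'i \<Rightarrow> 'k::field"
proof (induction rule: finite_induct)
  interpret kspace "\<bbbK> :: ('k, 'k) module"
    by (rule kspace_ground)
  { case empty show ?case using finsum_empty by simp }
  { case (insert x F) then show ?case using finsum_insert [of F x f] by simp }
qed

text \<open>Linearity on the carrier only. Maps such as \<open>incl A\<close>, \<open>coprod A\<close> and \<open>id\<close> are not extensional and so
  are not elements of \<open>Lin\<close>.\<close>

definition lin_on :: "('k::field, 'v) module \<Rightarrow> ('k, 'w) module \<Rightarrow> ('v \<Rightarrow> 'w) \<Rightarrow> bool" where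
  "lin_on V W f \<longleftrightarrow> (\<forall>x\<in>carrier V. f x \<in> carrier W) \<and>
     (\<forall>x\<in>carrier V. \<forall>y\<in>carrier V. f (x \<oplus>\<^bsub>V\<^esub> y) = f x \<oplus>\<^bsub>W\<^esub> f y) \<and>
     (\<forall>c. \<forall>x\<in>carrier V. f (c \<odot>\<^bsub>V\<^esub> x) = c \<odot>\<^bsub>W\<^esub> f x)"

lemma lin_onI:
  assumes "\<And>x. x \<in> carrier V \<Longrightarrow> f x \<in> carrier W"
    and "\<And>x y. x \<in> carrier V \<Longrightarrow> y \<in> carrier V \<Longrightarrow> f (x \<oplus>\<^bsub>V\<^esub> y) = f x \<oplus>\<^bsub>W\<^esub> f y"
    and "\<And>c x. x \<in> carrier V \<Longrightarrow> f (c \<odot>\<^bsub>V\<^esub> x) = c \<odot>\<^bsub>W\<^esub> f x"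
  shows "lin_on V W f"
  using assms by (auto simp: lin_on_def)

lemma lin_onD:
  assumes "lin_on V W f"
  shows "x \<in> carrier V \<Longrightarrow> f x \<in> carrier W"
    and "x \<in> carrier V \<Longrightarrow> y \<in> carrier V \<Longrightarrow> f (x \<oplus>\<^bsub>V\<^esub> y) = f x \<oplus>\<^bsub>W\<^esub> f y"
    and "x \<in> carrier V \<Longrightarrow> f (c \<odot>\<^bsub>V\<^esub> x) = c \<odot>\<^bsub>W\<^esub> f x"
  using assms by (auto simp: lin_on_def)

lemma Lin_iff: "f \<in> Lin V W \<longleftrightarrow> lin_on V W f \<and> f \<in> extensional (carrier V)"
  by (auto simp: Lin_def lin_on_def PiE_def)

lemma lin_on_zero:
  assumes "kspace V" "kspace W" "lin_on V W f"
  shows "f \<zero>\<^bsub>V\<^esub> = \<zero>\<^bsub>W\<^esub>"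
proof -
  interpret V: kspace V by fact
  interpret W: kspace W by fact
  have "f \<zero>\<^bsub>V\<^esub> = f (0 \<odot>\<^bsub>V\<^esub> \<zero>\<^bsub>V\<^esub>)" by simp
  also have "\<dots> = 0 \<odot>\<^bsub>W\<^esub> f \<zero>\<^bsub>V\<^esub>" using lin_onD(3) [OF assms(3)] by blast
  finally show ?thesis using lin_onD(1) [OF assms(3)] by simp
qed

lemma lin_on_finsum:
  assumes "kspace V" "kspace W" "lin_on V W f"
  assumes "finite I" "\<And>i. i \<in> I \<Longrightarrow> g i \<in> carrier V"
  shows "f (\<Oplus>\<^bsub>V\<^esub>i\<in>I. g i) = (\<Oplus>\<^bsub>W\<^esub>i\<in>I. f (g i))"
proof -
  interpret V: kspace V by fact
  interpret W: kspace W by fact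
  show ?thesis using assms(4,5)
  proof (induction rule: finite_induct)
    case empty
    then show ?case using lin_on_zero [OF assms(1-3)] by simp
  next
    case (insert x F)
    then have "(\<lambda>i. f (g i)) \<in> F \<rightarrow> carrier W" "f (g x) \<in> carrier W" "g \<in> F \<rightarrow> carrier V"
      using lin_onD(1) [OF assms(3)] by auto
    then show ?case using insert lin_onD(2) [OF assms(3)] by simp
  qed
qed

lemma lin_on_comp:
  assumes "lin_on U V f" "lin_on V W g"
  shows "lin_on U W (\<lambda>x. g (f x))"
  using assms by (simp add: lin_on_def)

lemma lin_on_cong:
  assumes "\<And>x. x \<in> carrier V \<Longrightarrow> f x = g x" "kspace V" "lin_on V W f"
  shows "lin_on V W g"
proof -
  interpret V: kspace V by fact
  show ?thesis
    using assms(1,3) by (auto simp: lin_on_def simp flip: assms(1))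
qed

lemma restrict_Lin:
  assumes "kspace V" "lin_on V W f"
  shows "(\<lambda>x\<in>carrier V. f x) \<in> Lin V W"
  unfolding Lin_iff by (auto intro: lin_on_cong [OF _ assms])


section \<open>Linear maps out of a presented space\<close>

definition supp_on :: "'x set \<Rightarrow> ('x \<Rightarrow>\<^sub>0 'k::field) set" where
  "supp_on X = {p. Poly_Mapping.keys p \<subseteq> X}"

lemma mem_supp_on: "p \<in> supp_on X \<longleftrightarrow> (\<forall>x. x \<notin> X \<longrightarrow> Poly_Mapping.lookup p x = 0)"
  by (auto simp: supp_on_def in_keys_iff)

lemma supp_on_0 [simp]: "0 \<in> supp_on X"
  and supp_on_add: "p \<in> supp_on X \<Longrightarrow> q \<in> supp_on X \<Longrightarrow> p + q \<in> supp_on X"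
  and supp_on_diff: "p \<in> supp_on X \<Longrightarrow> q \<in> supp_on X \<Longrightarrow> p - q \<in> supp_on X"
  and supp_on_single: "x \<in> X \<Longrightarrow> Poly_Mapping.single x c \<in> supp_on X"
  and supp_on_scale: "p \<in> supp_on X \<Longrightarrow> scale_pm c p \<in> supp_on X"
  by (auto simp: mem_supp_on lookup_add lookup_minus lookup_scale_pm lookup_single when_def)

lemmas supp_on_intros = supp_on_0 supp_on_add supp_on_diff supp_on_single supp_on_scale

lemma subspace_supp_on: "pm.subspace (supp_on X)"
  by (auto simp: pm.subspace_def intro: supp_on_intros)

lemma scale_single [simp]: "scale_pm c (Poly_Mapping.single x d) = Poly_Mapping.single x (c * d)"
  by (rule poly_mapping_eqI) (simp add: lookup_scale_pm lookup_single when_def)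

lemma supp_on_induct [consumes 1, case_names zero step]:
  assumes p: "p \<in> supp_on X"
    and zero: "P 0"
    and step: "\<And>x c q. x \<in> X \<Longrightarrow> q \<in> supp_on X \<Longrightarrow> P q \<Longrightarrow> P (Poly_Mapping.single x c + q)"
  shows "P (p :: 'x \<Rightarrow>\<^sub>0 'k::field)"
proof -
  have "finite K \<Longrightarrow> K \<subseteq> X \<Longrightarrow> (\<forall>p. Poly_Mapping.keys p \<subseteq> K \<longrightarrow> P p)" for K
  proof (induction rule: finite_induct)
    case empty
    then show ?case using zero by auto
  next
    case (insert x F)
    show ?case
    proof (intro allI impI)
      fix p :: "'x \<Rightarrow>\<^sub>0 'k" assume keys: "Poly_Mapping.keys p \<subseteq> insert x F"
      define q where "q = p - Poly_Mapping.single x (Poly_Mapping.lookup p x)"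
      have "Poly_Mapping.keys q \<subseteq> F"
      proof
        fix y assume "y \<in> Poly_Mapping.keys q"
        then show "y \<in> F" using keys
          by (cases "y = x") (auto simp: q_def in_keys_iff lookup_minus lookup_single subset_iff)
      qed
      then have "P (Poly_Mapping.single x (Poly_Mapping.lookup p x) + q)"
        using insert by (intro step) (auto simp: supp_on_def)
      then show "P p" by (simp add: q_def)
    qed
  qed
  from this [of "Poly_Mapping.keys p"] p show ?thesis by (simp add: supp_on_def)
qed

text \<open>The linear extension of \<open>f\<close> to formal combinations, of which \<open>lin_ext\<close> is the version on classes.\<close>

definition ev :: "('k::field, 'w) module \<Rightarrow> ('x \<Rightarrow> 'w) \<Rightarrow> ('x \<Rightarrow>\<^sub>0 'k) \<Rightarrow> 'w" where
  "ev W f p = (\<Oplus>\<^bsub>W\<^esub>x\<in>Poly_Mapping.keys p. Poly_Mapping.lookup p x \<odot>\<^bsub>W\<^esub> f x)"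

context kspace
begin

context
  fixes f :: "'x \<Rightarrow> 'w" and X :: "'x set"
  assumes f: "\<And>x. x \<in> X \<Longrightarrow> f x \<in> carrier W"
begin

lemma ev_superset:
  assumes "p \<in> supp_on X" "finite K" "Poly_Mapping.keys p \<subseteq> K" "K \<subseteq> X"
  shows "ev W f p = (\<Oplus>x\<in>K. Poly_Mapping.lookup p x \<odot> f x)"
  unfolding ev_def
proof (rule add.finprod_mono_neutral_cong_left)
  show "\<And>i. i \<in> K - Poly_Mapping.keys p \<Longrightarrow> Poly_Mapping.lookup p i \<odot> f i = \<zero>"
    using assms f by (auto simp: in_keys_iff)
qed (use assms f in auto)

lemma ev_closed: "p \<in> supp_on X \<Longrightarrow> ev W f p \<in> carrier W"
  unfolding ev_def by (rule finsum_closed) (use f in \<open>auto simp: supp_on_def\<close>)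

lemma ev_add:
  assumes "p \<in> supp_on X" "q \<in> supp_on X"
  shows "ev W f (p + q) = ev W f p \<oplus> ev W f q"
proof -
  define K where "K = Poly_Mapping.keys p \<union> Poly_Mapping.keys q"
  have K: "finite K" "K \<subseteq> X" using assms by (auto simp: K_def supp_on_def)
  have *: "Poly_Mapping.keys (p + q) \<subseteq> K" "Poly_Mapping.keys p \<subseteq> K" "Poly_Mapping.keys q \<subseteq> K"
    using keys_add [of p q] by (auto simp: K_def)
  have "ev W f (p + q) = (\<Oplus>x\<in>K. Poly_Mapping.lookup (p + q) x \<odot> f x)"
    by (rule ev_superset) (use assms K * in \<open>auto intro: supp_on_intros\<close>)
  also have "\<dots> = (\<Oplus>x\<in>K. Poly_Mapping.lookup p x \<odot> f x \<oplus> Poly_Mapping.lookup q x \<odot> f x)"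
    by (rule finsum_cong') (use K f in \<open>auto simp: lookup_add smult_add_left subset_iff\<close>)
  also have "\<dots> = ev W f p \<oplus> ev W f q"
    using K f by (subst finsum_addf) (auto simp: ev_superset [OF _ K(1) *(2) K(2)]
        ev_superset [OF _ K(1) *(3) K(2)] assms)
  finally show ?thesis .
qed

lemma ev_scale:
  assumes "p \<in> supp_on X"
  shows "ev W f (scale_pm c p) = c \<odot> ev W f p"
proof -
  define K where "K = Poly_Mapping.keys p"
  have K: "finite K" "K \<subseteq> X" using assms by (auto simp: K_def supp_on_def)
  have *: "Poly_Mapping.keys (scale_pm c p) \<subseteq> K"
    by (auto simp: K_def in_keys_iff lookup_scale_pm)
  have "ev W f (scale_pm c p) = (\<Oplus>x\<in>K. Poly_Mapping.lookup (scale_pm c p) x \<odot> f x)"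
    by (rule ev_superset) (use assms K * in \<open>auto intro: supp_on_intros\<close>)
  also have "\<dots> = (\<Oplus>x\<in>K. c \<odot> (Poly_Mapping.lookup p x \<odot> f x))"
    by (rule finsum_cong') (use K f in \<open>auto simp: lookup_scale_pm smult_smult subset_iff\<close>)
  also have "\<dots> = c \<odot> ev W f p"
    unfolding ev_def K_def [symmetric] by (rule finsum_smult [symmetric]) (use K f in auto)
  finally show ?thesis .
qed

lemma ev_single: "x \<in> X \<Longrightarrow> ev W f (Poly_Mapping.single x c) = c \<odot> f x"
  using f by (subst ev_superset [of _ "{x}"]) (auto intro: supp_on_intros)

lemma ev_0 [simp]: "ev W f 0 = \<zero>"
  by (simp add: ev_def)

lemma ev_diff_eq_zero_iff:
  assumes "p \<in> supp_on X" "q \<in> supp_on X"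
  shows "ev W f (p - q) = \<zero> \<longleftrightarrow> ev W f p = ev W f q"
proof -
  have "ev W f p = ev W f (p - q) \<oplus> ev W f q"
    using ev_add [of "p - q" q] assms by (simp add: supp_on_intros)
  then show ?thesis using assms by (metis ev_closed supp_on_diff l_zero add.r_cancel_one')
qed

lemma ev_span_zero:
  assumes R: "R \<subseteq> supp_on X" "\<And>r. r \<in> R \<Longrightarrow> ev W f r = \<zero>" and r: "r \<in> span_pm R"
  shows "ev W f r = \<zero>"
proof -
  have "pm.subspace (supp_on X \<inter> {p. ev W f p = \<zero>})"
    unfolding pm.subspace_def
    by (auto intro: supp_on_intros simp: ev_add ev_scale)
  then have "span_pm R \<subseteq> supp_on X \<inter> {p. ev W f p = \<zero>}"
    by (intro pm.span_minimal) (use R in auto)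
  then show ?thesis using r by auto
qed

end

end

text \<open>Classes are cosets of \<open>span_pm R\<close>, so the unions in the operations of \<open>presented\<close> collapse to the
  class of any representative.\<close>

lemma cls_eq_iff: "cls R p = cls R q \<longleftrightarrow> p - q \<in> span_pm R"
proof
  assume "cls R p = cls R q"
  moreover have "p \<in> cls R p" by (simp add: cls_def pm.span_zero)
  ultimately show "p - q \<in> span_pm R" by (simp add: cls_def)
next
  assume *: "p - q \<in> span_pm R"
  have "r - p \<in> span_pm R \<longleftrightarrow> r - q \<in> span_pm R" for r
    using pm.span_add [OF * , of "r - p"] pm.span_diff [OF _ *, of "r - q"] by (auto simp: algebra_simps)
  then show "cls R p = cls R q" by (simp add: cls_def)
qed

lemma mem_cls: "q \<in> cls R p \<longleftrightarrow> cls R q = cls R p"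
  by (simp add: cls_eq_iff) (simp add: cls_def)

lemma UN_cls:
  assumes "\<And>q. q \<in> cls R p \<Longrightarrow> F q = F p"
  shows "(\<Union>q\<in>cls R p. F q) = F p"
proof -
  have "p \<in> cls R p" by (simp add: mem_cls)
  then show ?thesis using assms by blast
qed

lemma presented_add [simp]: "cls R p \<oplus>\<^bsub>presented M R\<^esub> cls R q = cls R (p + q)"
proof -
  have "(\<Union>p'\<in>cls R p. \<Union>q'\<in>cls R q. cls R (p' + q')) = (\<Union>p'\<in>cls R p. cls R (p' + q))"
    by (intro SUP_cong refl UN_cls) (simp add: cls_eq_iff, simp add: cls_def)
  also have "\<dots> = cls R (p + q)"
    by (intro UN_cls) (simp add: cls_eq_iff, simp add: cls_def)
  finally show ?thesis by (simp add: presented_def)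
qed

lemma presented_smult [simp]: "c \<odot>\<^bsub>presented M R\<^esub> cls R p = cls R (scale_pm c p)"
proof -
  have "(\<Union>p'\<in>cls R p. cls R (scale_pm c p')) = cls R (scale_pm c p)"
    by (intro UN_cls) (simp add: cls_eq_iff flip: pm.scale_right_diff_distrib,
        simp add: cls_def pm.span_scale)
  then show ?thesis by (simp add: presented_def)
qed

lemma presented_zero: "\<zero>\<^bsub>presented M R\<^esub> = cls R 0"
  and presented_one: "\<one>\<^bsub>presented M R\<^esub> = cls R (Poly_Mapping.single \<one>\<^bsub>M\<^esub> 1)"
  and presented_carrier: "carrier (presented M R) = cls R ` supp_on (carrier M)"
  by (auto simp: presented_def supp_on_def)

lemma kspace_presented: "kspace (presented M R)"
  by (rule kspaceI)
    (auto simp: presented_zero presented_carrier algebra_simps pm.scale_left_distrib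
      pm.scale_right_distrib intro!: imageI intro: supp_on_intros)

definition gen :: "('x \<Rightarrow>\<^sub>0 'k::field) set \<Rightarrow> 'x \<Rightarrow> ('x \<Rightarrow>\<^sub>0 'k) set" where
  "gen R x = cls R (Poly_Mapping.single x 1)"

lemma gen_closed: "x \<in> carrier M \<Longrightarrow> gen R x \<in> carrier (presented M R)"
  by (auto simp: gen_def presented_carrier intro: supp_on_intros)

text \<open>Every element of a presented space is a linear combination of classes of generators; this form adds
  one term at a time.\<close>

lemma presented_induct [consumes 1, case_names zero step]:
  assumes "x \<in> carrier (presented M R)"
    and "P \<zero>\<^bsub>presented M R\<^esub>"
    and "\<And>m c y. m \<in> carrier M \<Longrightarrow> y \<in> carrier (presented M R) \<Longrightarrow> P y \<Longrightarrow>
      P (c \<odot>\<^bsub>presented M R\<^esub> gen R m \<oplus>\<^bsub>presented M R\<^esub> y)"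
  shows "P x"
proof -
  from assms(1) obtain p where x: "x = cls R p" and p: "p \<in> supp_on (carrier M)"
    by (auto simp: presented_carrier)
  from p have "P (cls R p)"
  proof (induction rule: supp_on_induct)
    case zero
    then show ?case using assms(2) by (simp add: presented_zero)
  next
    case (step m c q)
    then show ?case using assms(3) [of m "cls R q" c]
      by (auto simp: gen_def presented_carrier)
  qed
  then show ?thesis by (simp add: x)
qed

lemma lin_on_presented_eqI:
  assumes "kspace W" "lin_on (presented M R) W f" "lin_on (presented M R) W g"
    and "\<And>m. m \<in> carrier M \<Longrightarrow> f (gen R m) = g (gen R m)"
    and "x \<in> carrier (presented M R)"
  shows "f x = g x"
  using assms(5)
proof (induction rule: presented_induct)
  case zero
  then show ?case using lin_on_zero [OF kspace_presented] assms by metis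
next
  case (step m c y)
  interpret kspace "presented M R" by (rule kspace_presented)
  show ?case using step assms by (simp add: lin_onD gen_closed)
qed

text \<open>The universal property of a presentation. Relations supported on the generators ensure that every
  representative of a class in the carrier is again supported on the generators, so that the
  representative chosen by \<open>lin_ext\<close> evaluates like any other.\<close>

lemma lin_ext_presented:
  assumes W: "kspace W" and R: "R \<subseteq> supp_on (carrier M)"
    and f: "\<And>m. m \<in> carrier M \<Longrightarrow> f m \<in> carrier W"
    and kill: "\<And>r. r \<in> R \<Longrightarrow> ev W f r = \<zero>\<^bsub>W\<^esub>"
  shows lin_ext_presented_lin: "lin_on (presented M R) W (lin_ext W f)"
    and lin_ext_presented_gen: "m \<in> carrier M \<Longrightarrow> lin_ext W f (gen R m) = f m"
proof -
  interpret W: kspace W by fact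
  have *: "lin_ext W f (cls R p) = ev W f p" if p: "p \<in> supp_on (carrier M)" for p
  proof -
    define q where "q = (SOME q. q \<in> cls R p)"
    have "p \<in> cls R p" by (simp add: mem_cls)
    then have "q \<in> cls R p" unfolding q_def by (rule someI)
    then have q: "q - p \<in> span_pm R" by (simp add: cls_def)
    have "span_pm R \<subseteq> supp_on (carrier M)"
      using R by (intro pm.span_minimal subspace_supp_on)
    then have "(q - p) + p \<in> supp_on (carrier M)" using q p by (intro supp_on_add) auto
    then have "q \<in> supp_on (carrier M)" by simp
    moreover have "ev W f (q - p) = \<zero>\<^bsub>W\<^esub>"
      by (rule W.ev_span_zero [OF _ R kill q]) (use f in auto)
    ultimately have "ev W f q = ev W f p"
      using W.ev_diff_eq_zero_iff [of "carrier M" f q p] f p by auto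
    then show ?thesis by (simp add: lin_ext_def ev_def q_def Let_def)
  qed
  show "lin_on (presented M R) W (lin_ext W f)"
    by (rule lin_onI) (auto simp: presented_carrier * supp_on_intros
        W.ev_closed [of "carrier M"] W.ev_add [of "carrier M"] W.ev_scale [of "carrier M"] f)
  show "lin_ext W f (gen R m) = f m" if "m \<in> carrier M"
    using that f by (simp add: gen_def * supp_on_intros W.ev_single [of "carrier M"])
qed


section \<open>Products on presented spaces\<close>

text \<open>A vector space with a bilinear product and a right unit. This is the structure under which
  multiplying a list of factors, folded from the right onto the unit, is multilinear in the factors.\<close>

locale kalg = kspace W for W :: "('k::field, 'w) module" (structure) +
  assumes mult_closed [simp, intro]: "x \<in> carrier W \<Longrightarrow> y \<in> carrier W \<Longrightarrow> x \<otimes> y \<in> carrier W"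
    and unit_closed [simp, intro]: "\<one> \<in> carrier W"
    and mult_add_left: "x \<in> carrier W \<Longrightarrow> y \<in> carrier W \<Longrightarrow> z \<in> carrier W \<Longrightarrow>
      (x \<oplus> y) \<otimes> z = x \<otimes> z \<oplus> y \<otimes> z"
    and mult_add_right: "x \<in> carrier W \<Longrightarrow> y \<in> carrier W \<Longrightarrow> z \<in> carrier W \<Longrightarrow>
      z \<otimes> (x \<oplus> y) = z \<otimes> x \<oplus> z \<otimes> y"
    and mult_smult_left: "x \<in> carrier W \<Longrightarrow> y \<in> carrier W \<Longrightarrow> (c \<odot> x) \<otimes> y = c \<odot> (x \<otimes> y)"
    and mult_smult_right: "x \<in> carrier W \<Longrightarrow> y \<in> carrier W \<Longrightarrow> x \<otimes> (c \<odot> y) = c \<odot> (x \<otimes> y)"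
    and mult_unit: "x \<in> carrier W \<Longrightarrow> x \<otimes> \<one> = x"
begin

lemma lin_on_mult_left: "x \<in> carrier W \<Longrightarrow> lin_on W W (\<lambda>y. x \<otimes> y)"
  and lin_on_mult_right: "x \<in> carrier W \<Longrightarrow> lin_on W W (\<lambda>y. y \<otimes> x)"
  by (auto intro!: lin_onI simp: mult_add_left mult_add_right mult_smult_left mult_smult_right)

end

lemma kalg_ground: "kalg (\<bbbK> :: ('k::field, 'k) module)"
  by (rule kalg.intro [OF kspace_ground]) (unfold_locales, auto simp: algebra_simps)

lemma mult_pm_superset:
  assumes "finite K" "Poly_Mapping.keys p \<subseteq> K" "finite L" "Poly_Mapping.keys q \<subseteq> L"
  shows "mult_pm M p q = (\<Sum>x\<in>K. \<Sum>y\<in>L.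
     Poly_Mapping.single (x \<otimes>\<^bsub>M\<^esub> y) (Poly_Mapping.lookup p x * Poly_Mapping.lookup q y))"
proof -
  have "mult_pm M p q = (\<Sum>x\<in>Poly_Mapping.keys p. \<Sum>y\<in>L.
     Poly_Mapping.single (x \<otimes>\<^bsub>M\<^esub> y) (Poly_Mapping.lookup p x * Poly_Mapping.lookup q y))"
    unfolding mult_pm_def
    by (intro sum.cong refl sum.mono_neutral_left) (use assms in \<open>auto simp: in_keys_iff\<close>)
  also have "\<dots> = (\<Sum>x\<in>K. \<Sum>y\<in>L.
     Poly_Mapping.single (x \<otimes>\<^bsub>M\<^esub> y) (Poly_Mapping.lookup p x * Poly_Mapping.lookup q y))"
    by (intro sum.mono_neutral_left) (use assms in \<open>auto simp: in_keys_iff\<close>)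
  finally show ?thesis .
qed

lemma mult_pm_add_left: "mult_pm M (p + p') q = mult_pm M p q + mult_pm M p' q"
proof -
  let ?K = "Poly_Mapping.keys p \<union> Poly_Mapping.keys p'" and ?L = "Poly_Mapping.keys q"
  show ?thesis
    using keys_add [of p p']
    by (simp add: mult_pm_superset [of ?K _ ?L] lookup_add distrib_right single_add sum.distrib)
qed

lemma mult_pm_add_right: "mult_pm M p (q + q') = mult_pm M p q + mult_pm M p q'"
proof -
  let ?L = "Poly_Mapping.keys q \<union> Poly_Mapping.keys q'" and ?K = "Poly_Mapping.keys p"
  show ?thesis
    using keys_add [of q q']
    by (simp add: mult_pm_superset [of ?K _ ?L] lookup_add distrib_left single_add sum.distrib)
qed

lemma mult_pm_scale_left: "mult_pm M (scale_pm c p) q = scale_pm c (mult_pm M p q)"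
proof -
  have "Poly_Mapping.keys (scale_pm c p) \<subseteq> Poly_Mapping.keys p"
    by (auto simp: in_keys_iff lookup_scale_pm)
  then show ?thesis
    by (simp add: mult_pm_superset [of "Poly_Mapping.keys p" _ "Poly_Mapping.keys q"]
        lookup_scale_pm pm.scale_sum_right mult.assoc)
qed

lemma mult_pm_scale_right: "mult_pm M p (scale_pm c q) = scale_pm c (mult_pm M p q)"
proof -
  have "Poly_Mapping.keys (scale_pm c q) \<subseteq> Poly_Mapping.keys q"
    by (auto simp: in_keys_iff lookup_scale_pm)
  then show ?thesis
    by (simp add: mult_pm_superset [of "Poly_Mapping.keys p" _ "Poly_Mapping.keys q"]
        lookup_scale_pm pm.scale_sum_right mult.left_commute)
qed

lemma mult_pm_0 [simp]: "mult_pm M 0 q = 0" "mult_pm M p 0 = 0"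
  by (simp_all add: mult_pm_def)

lemma mult_pm_single [simp]:
  "mult_pm M (Poly_Mapping.single x a) (Poly_Mapping.single y b) = Poly_Mapping.single (x \<otimes>\<^bsub>M\<^esub> y) (a * b)"
  by (subst mult_pm_superset [of "{x}" _ "{y}"]) auto

lemma mult_pm_diff_left: "mult_pm M (p - p') q = mult_pm M p q - mult_pm M p' q"
  using mult_pm_add_left [of M "p - p'" p' q] by (simp add: algebra_simps)

lemma mult_pm_diff_right: "mult_pm M p (q - q') = mult_pm M p q - mult_pm M p q'"
  using mult_pm_add_right [of M p "q - q'" q'] by (simp add: algebra_simps)

text \<open>The conditions on generators and relations under which the product descends to the quotient: the
  span of \<open>R\<close> is a two-sided ideal as soon as it absorbs multiplication by generators.\<close>

locale presented_kalg =
  fixes M :: "('x, 'm) monoid_scheme" and R :: "('x \<Rightarrow>\<^sub>0 'k::field) set"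
  assumes M_closed: "x \<in> carrier M \<Longrightarrow> y \<in> carrier M \<Longrightarrow> x \<otimes>\<^bsub>M\<^esub> y \<in> carrier M"
    and M_one: "\<one>\<^bsub>M\<^esub> \<in> carrier M"
    and M_r_one: "x \<in> carrier M \<Longrightarrow> x \<otimes>\<^bsub>M\<^esub> \<one>\<^bsub>M\<^esub> = x"
    and R_supp: "R \<subseteq> supp_on (carrier M)"
    and R_left: "x \<in> carrier M \<Longrightarrow> r \<in> R \<Longrightarrow> mult_pm M (Poly_Mapping.single x 1) r \<in> span_pm R"
    and R_right: "x \<in> carrier M \<Longrightarrow> r \<in> R \<Longrightarrow> mult_pm M r (Poly_Mapping.single x 1) \<in> span_pm R"
begin

lemma supp_mult: "p \<in> supp_on (carrier M) \<Longrightarrow> q \<in> supp_on (carrier M) \<Longrightarrow>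
    mult_pm M p q \<in> supp_on (carrier M)"
  unfolding mult_pm_def
  by (intro pm.subspace_sum [OF subspace_supp_on] supp_on_single M_closed) (auto simp: supp_on_def)

lemma span_mult:
  assumes p: "p \<in> supp_on (carrier M)" and r: "r \<in> span_pm R"
  shows "mult_pm M p r \<in> span_pm R" "mult_pm M r p \<in> span_pm R"
proof -
  have 1: "mult_pm M (Poly_Mapping.single x 1) r \<in> span_pm R" if "x \<in> carrier M" for x
  proof -
    have "pm.subspace {r. mult_pm M (Poly_Mapping.single x 1) r \<in> span_pm R}"
      by (auto simp: pm.subspace_def mult_pm_add_right mult_pm_scale_right
          intro: pm.span_zero pm.span_add pm.span_scale)
    then have "span_pm R \<subseteq> {r. mult_pm M (Poly_Mapping.single x 1) r \<in> span_pm R}"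
      by (intro pm.span_minimal) (use R_left that in auto)
    then show ?thesis using r by auto
  qed
  have 2: "mult_pm M r (Poly_Mapping.single x 1) \<in> span_pm R" if "x \<in> carrier M" for x
  proof -
    have "pm.subspace {r. mult_pm M r (Poly_Mapping.single x 1) \<in> span_pm R}"
      by (auto simp: pm.subspace_def mult_pm_add_left mult_pm_scale_left
          intro: pm.span_zero pm.span_add pm.span_scale)
    then have "span_pm R \<subseteq> {r. mult_pm M r (Poly_Mapping.single x 1) \<in> span_pm R}"
      by (intro pm.span_minimal) (use R_right that in auto)
    then show ?thesis using r by auto
  qed
  from p show "mult_pm M p r \<in> span_pm R"
  proof (induction rule: supp_on_induct)
    case zero
    then show ?case by (simp add: pm.span_zero)
  next
    case (step x c q)
    have "mult_pm M (Poly_Mapping.single x c) r = scale_pm c (mult_pm M (Poly_Mapping.single x 1) r)"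
      by (simp flip: mult_pm_scale_left)
    then show ?case
      using step 1 by (auto simp: mult_pm_add_left intro: pm.span_add pm.span_scale)
  qed
  from p show "mult_pm M r p \<in> span_pm R"
  proof (induction rule: supp_on_induct)
    case zero
    then show ?case by (simp add: pm.span_zero)
  next
    case (step x c q)
    have "mult_pm M r (Poly_Mapping.single x c) = scale_pm c (mult_pm M r (Poly_Mapping.single x 1))"
      by (simp flip: mult_pm_scale_right)
    then show ?case
      using step 2 by (auto simp: mult_pm_add_right intro: pm.span_add pm.span_scale)
  qed
qed

lemma cls_mult:
  assumes p: "p \<in> supp_on (carrier M)" and q: "q \<in> supp_on (carrier M)"
  shows "cls R p \<otimes>\<^bsub>presented M R\<^esub> cls R q = cls R (mult_pm M p q)"
proof -
  have supp: "p' \<in> supp_on (carrier M)" if "p' \<in> cls R p" for p'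
  proof -
    have "span_pm R \<subseteq> supp_on (carrier M)"
      by (intro pm.span_minimal R_supp subspace_supp_on)
    then have "(p' - p) + p \<in> supp_on (carrier M)"
      using that p by (intro supp_on_add) (auto simp: cls_def)
    then show ?thesis by simp
  qed
  have "(\<Union>p'\<in>cls R p. \<Union>q'\<in>cls R q. cls R (mult_pm M p' q')) = (\<Union>p'\<in>cls R p. cls R (mult_pm M p' q))"
    by (intro SUP_cong refl UN_cls)
      (simp add: cls_eq_iff flip: mult_pm_diff_right, simp add: cls_def span_mult supp)
  also have "\<dots> = cls R (mult_pm M p q)"
    by (intro UN_cls)
      (simp add: cls_eq_iff flip: mult_pm_diff_left, simp add: cls_def span_mult q)
  finally show ?thesis by (simp add: presented_def)
qed

lemma gen_mult: "x \<in> carrier M \<Longrightarrow> y \<in> carrier M \<Longrightarrow>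
    gen R x \<otimes>\<^bsub>presented M R\<^esub> gen R y = gen R (x \<otimes>\<^bsub>M\<^esub> y)"
  by (simp add: gen_def cls_mult supp_on_single)

lemma kalg_presented: "kalg (presented M R)"
proof (rule kalg.intro [OF kspace_presented], unfold_locales)
  show "x \<otimes>\<^bsub>presented M R\<^esub> \<one>\<^bsub>presented M R\<^esub> = x" if x: "x \<in> carrier (presented M R)" for x
  proof -
    obtain p where p: "x = cls R p" "p \<in> supp_on (carrier M)"
      using x by (auto simp: presented_carrier)
    have "mult_pm M p (Poly_Mapping.single \<one>\<^bsub>M\<^esub> 1) = p"
      using p(2) by (induction rule: supp_on_induct) (auto simp: mult_pm_add_left M_r_one)
    then show ?thesis
      by (simp add: p presented_one cls_mult supp_on_single M_one)
  qed
qed (auto simp: presented_carrier presented_one cls_mult supp_mult mult_pm_add_left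
    mult_pm_add_right mult_pm_scale_left mult_pm_scale_right supp_on_intros M_one)

end


section \<open>The tensor algebra\<close>

definition multilin :: "('k::field, 'v) module \<Rightarrow> ('k, 'w) module \<Rightarrow> ('v list \<Rightarrow> 'w) \<Rightarrow> bool" where
  "multilin V W F \<longleftrightarrow> (\<forall>w\<in>lists (carrier V). F w \<in> carrier W) \<and>
     (\<forall>u\<in>lists (carrier V). \<forall>v\<in>lists (carrier V). lin_on V W (\<lambda>x. F (u @ [x] @ v)))"

lemma multilinI:
  assumes "\<And>w. w \<in> lists (carrier V) \<Longrightarrow> F w \<in> carrier W"
    and "\<And>u v. u \<in> lists (carrier V) \<Longrightarrow> v \<in> lists (carrier V) \<Longrightarrow> lin_on V W (\<lambda>x. F (u @ [x] @ v))"
  shows "multilin V W F"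
  using assms by (auto simp: multilin_def)

lemma multilinD:
  assumes "multilin V W F"
  shows "w \<in> lists (carrier V) \<Longrightarrow> F w \<in> carrier W"
    and "u \<in> lists (carrier V) \<Longrightarrow> v \<in> lists (carrier V) \<Longrightarrow> lin_on V W (\<lambda>x. F (u @ [x] @ v))"
  using assms by (auto simp: multilin_def)

text \<open>\<open>Tplus\<close> is presented by the nonempty words, since every relation already involves nonempty words
  only. The general facts on presented spaces thus apply to it directly.\<close>

lemma Tplus_presented:
  "Tplus V = presented ((word_monoid V)\<lparr>carrier := lists (carrier V) - {[]}\<rparr>) (multilinear_rels V)"
  by (simp add: Tplus_def Tbar_def presented_def mult_pm_def)

lemma word_monoid_simps [simp]:
  "carrier (word_monoid V) = lists (carrier V)" "x \<otimes>\<^bsub>word_monoid V\<^esub> y = x @ y" "\<one>\<^bsub>word_monoid V\<^esub> = []"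
  by (simp_all add: word_monoid_def)

lemma word_gen: "word V w = gen (multilinear_rels V) w"
  by (simp add: word_def gen_def)

lemma kspace_Tbar: "kspace (Tbar V)" and kspace_Tplus: "kspace (Tplus V)"
  by (simp_all add: Tbar_def Tplus_presented kspace_presented)

lemma Tplus_ops [simp]:
  "(\<oplus>\<^bsub>Tplus V\<^esub>) = (\<oplus>\<^bsub>Tbar V\<^esub>)" "(\<odot>\<^bsub>Tplus V\<^esub>) = (\<odot>\<^bsub>Tbar V\<^esub>)"
  by (simp_all add: Tplus_def)

lemma Tplus_subset: "carrier (Tplus V) \<subseteq> carrier (Tbar V)"
  by (auto simp: Tplus_def Tbar_def presented_def)

lemma word_closed: "w \<in> lists (carrier V) \<Longrightarrow> word V w \<in> carrier (Tbar V)"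
  by (simp add: word_gen Tbar_def gen_closed)

lemma word_closed_Tplus: "w \<in> lists (carrier V) \<Longrightarrow> w \<noteq> [] \<Longrightarrow> word V w \<in> carrier (Tplus V)"
  by (simp add: word_gen Tplus_presented gen_closed)

lemma one_Tbar: "\<one>\<^bsub>Tbar V\<^esub> = word V []"
  by (simp add: Tbar_def presented_one word_def)

context kspace
begin

lemma multilinear_rels_supp: "multilinear_rels W \<subseteq> supp_on (lists (carrier W) - {[]})"
  by (auto simp: multilinear_rels_def intro!: supp_on_intros)

lemma multilinear_rels_cases:
  assumes "r \<in> multilinear_rels W"
  obtains u x y v where "u \<in> lists (carrier W)" "v \<in> lists (carrier W)"
      "x \<in> carrier W" "y \<in> carrier W"
      "r = Poly_Mapping.single (u @ [x \<oplus> y] @ v) 1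
        - (Poly_Mapping.single (u @ [x] @ v) 1 + Poly_Mapping.single (u @ [y] @ v) 1)"
    | u c x v where "u \<in> lists (carrier W)" "v \<in> lists (carrier W)" "x \<in> carrier W"
      "r = Poly_Mapping.single (u @ [c \<odot> x] @ v) 1 - Poly_Mapping.single (u @ [x] @ v) c"
  using assms unfolding multilinear_rels_def
proof (elim UnE CollectE exE conjE)
qed (rule that(1), assumption+, simp add: diff_diff_eq, rule that(2), assumption+)

lemma multilinear_relsI:
  "u \<in> lists (carrier W) \<Longrightarrow> v \<in> lists (carrier W) \<Longrightarrow> x \<in> carrier W \<Longrightarrow> y \<in> carrier W \<Longrightarrow>
    Poly_Mapping.single (u @ [x \<oplus> y] @ v) 1
      - (Poly_Mapping.single (u @ [x] @ v) 1 + Poly_Mapping.single (u @ [y] @ v) 1)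
    \<in> multilinear_rels W"
  "u \<in> lists (carrier W) \<Longrightarrow> v \<in> lists (carrier W) \<Longrightarrow> x \<in> carrier W \<Longrightarrow>
    Poly_Mapping.single (u @ [c \<odot> x] @ v) 1 - Poly_Mapping.single (u @ [x] @ v) c
    \<in> multilinear_rels W"
  unfolding multilinear_rels_def diff_diff_eq [symmetric] by (rule UnI1, blast) (rule UnI2, blast)

lemma multilin_word: "multilin W (Tbar W) (word W)"
proof (rule multilinI)
  fix u v assume uv: "u \<in> lists (carrier W)" "v \<in> lists (carrier W)"
  show "lin_on W (Tbar W) (\<lambda>x. word W (u @ [x] @ v))"
  proof (rule lin_onI)
    fix x y assume xy: "x \<in> carrier W" "y \<in> carrier W"
    from multilinear_relsI(1) [OF uv xy]
    show "word W (u @ [x \<oplus> y] @ v) = word W (u @ [x] @ v) \<oplus>\<^bsub>Tbar W\<^esub> word W (u @ [y] @ v)"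
      by (simp add: word_def Tbar_def cls_eq_iff pm.span_base)
  next
    fix c x assume x: "x \<in> carrier W"
    from multilinear_relsI(2) [OF uv x, of c]
    show "word W (u @ [c \<odot> x] @ v) = c \<odot>\<^bsub>Tbar W\<^esub> word W (u @ [x] @ v)"
      by (simp add: word_def Tbar_def cls_eq_iff pm.span_base)
  qed (use uv in \<open>auto intro!: word_closed\<close>)
qed (rule word_closed)

lemma multilin_kills_rels:
  assumes U: "kspace U" and F: "multilin W U F" and r: "r \<in> multilinear_rels W"
  shows "ev U F r = \<zero>\<^bsub>U\<^esub>"
proof -
  interpret U: kspace U by fact
  note F_closed = multilinD(1) [OF F]
  note ev_single = U.ev_single [of "lists (carrier W)" F, OF F_closed]
  note ev_add = U.ev_add [of "lists (carrier W)" F, OF F_closed]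
  note ev_diff = U.ev_diff_eq_zero_iff [of "lists (carrier W)" F, OF F_closed]
  from r show ?thesis
  proof (cases rule: multilinear_rels_cases)
    case (1 u x y v)
    have "u @ [x \<oplus> y] @ v \<in> lists (carrier W)" "u @ [x] @ v \<in> lists (carrier W)"
      "u @ [y] @ v \<in> lists (carrier W)"
      using 1 by auto
    then show ?thesis
      using lin_onD(2) [OF multilinD(2) [OF F 1(1,2)] 1(3,4)] F_closed unfolding 1(5)
      by (simp add: ev_diff ev_add ev_single supp_on_intros del: append.simps)
  next
    case (2 u c x v)
    have "u @ [c \<odot> x] @ v \<in> lists (carrier W)" "u @ [x] @ v \<in> lists (carrier W)"
      using 2 by auto
    then show ?thesis
      using lin_onD(3) [OF multilinD(2) [OF F 2(1,2)] 2(3)] F_closed unfolding 2(4)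
      by (simp add: ev_diff ev_add ev_single supp_on_intros del: append.simps)
  qed
qed

lemma lin_ext_Tbar:
  assumes U: "kspace U" and F: "multilin W U F"
  shows "lin_on (Tbar W) U (lin_ext U F)"
    and "w \<in> lists (carrier W) \<Longrightarrow> lin_ext U F (word W w) = F w"
proof -
  have "multilinear_rels W \<subseteq> supp_on (carrier (word_monoid W))"
    using multilinear_rels_supp by (auto simp: supp_on_def)
  note * = lin_ext_presented [OF U this, of F]
  show "lin_on (Tbar W) U (lin_ext U F)"
    unfolding Tbar_def using multilinD(1) [OF F] multilin_kills_rels [OF U F] by (intro *) auto
  show "lin_ext U F (word W w) = F w" if "w \<in> lists (carrier W)"
    unfolding word_gen using multilinD(1) [OF F] multilin_kills_rels [OF U F] that by (intro *) auto
qed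

text \<open>Concatenating a word on either side of a multilinearity relation yields another such relation.\<close>

lemma presented_kalg_word: "presented_kalg (word_monoid W) (multilinear_rels W)"
proof
  show "multilinear_rels W \<subseteq> supp_on (carrier (word_monoid W))"
    using multilinear_rels_supp by (auto simp: supp_on_def)
next
  fix m r assume m: "m \<in> carrier (word_monoid W)" and r: "r \<in> multilinear_rels W"
  from r have "mult_pm (word_monoid W) (Poly_Mapping.single m 1) r \<in> multilinear_rels W"
  proof (cases rule: multilinear_rels_cases)
    case (1 u x y v)
    then show ?thesis
      using multilinear_relsI(1) [of "m @ u" v x y] m by (simp add: mult_pm_diff_right mult_pm_add_right)
  next
    case (2 u c x v)
    then show ?thesis
      using multilinear_relsI(2) [of "m @ u" v x c] m by (simp add: mult_pm_diff_right)
  qed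
  then show "mult_pm (word_monoid W) (Poly_Mapping.single m 1) r \<in> span_pm (multilinear_rels W)"
    by (rule pm.span_base)
  from r have "mult_pm (word_monoid W) r (Poly_Mapping.single m 1) \<in> multilinear_rels W"
  proof (cases rule: multilinear_rels_cases)
    case (1 u x y v)
    then show ?thesis
      using multilinear_relsI(1) [of u "v @ m" x y] m by (simp add: mult_pm_diff_left mult_pm_add_left)
  next
    case (2 u c x v)
    then show ?thesis
      using multilinear_relsI(2) [of u "v @ m" x c] m by (simp add: mult_pm_diff_left)
  qed
  then show "mult_pm (word_monoid W) r (Poly_Mapping.single m 1) \<in> span_pm (multilinear_rels W)"
    by (rule pm.span_base)
qed auto

lemma kalg_Tbar: "kalg (Tbar W)"
  unfolding Tbar_def by (rule presented_kalg.kalg_presented [OF presented_kalg_word])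

lemma word_mult: "u \<in> lists (carrier W) \<Longrightarrow> v \<in> lists (carrier W) \<Longrightarrow>
    word W u \<otimes>\<^bsub>Tbar W\<^esub> word W v = word W (u @ v)"
  using presented_kalg.gen_mult [OF presented_kalg_word, of u v] by (simp add: Tbar_def word_gen)

end

lemma lin_on_Tbar_eqI:
  assumes "kspace W" "lin_on (Tbar V) W f" "lin_on (Tbar V) W g"
    and "\<And>w. w \<in> lists (carrier V) \<Longrightarrow> f (word V w) = g (word V w)"
    and "x \<in> carrier (Tbar V)"
  shows "f x = g x"
  using lin_on_presented_eqI [of W "word_monoid V" "multilinear_rels V" f g x] assms
  by (simp add: Tbar_def word_gen)

lemma lin_on_Tplus_eqI:
  assumes "kspace W" "lin_on (Tplus V) W f" "lin_on (Tplus V) W g"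
    and "\<And>w. w \<in> lists (carrier V) \<Longrightarrow> w \<noteq> [] \<Longrightarrow> f (word V w) = g (word V w)"
    and "x \<in> carrier (Tplus V)"
  shows "f x = g x"
  using lin_on_presented_eqI [of W "(word_monoid V)\<lparr>carrier := lists (carrier V) - {[]}\<rparr>"
      "multilinear_rels V" f g x] assms
  by (simp add: Tplus_presented word_gen)

lemma lin_on_Tplus: "lin_on (Tbar V) W f \<Longrightarrow> lin_on (Tplus V) W f"
  using Tplus_subset [of V] by (simp add: lin_on_def subset_iff)


section \<open>Tensor products\<close>

definition bilin :: "('k::field, 'v) module \<Rightarrow> ('k, 'w) module \<Rightarrow> ('k, 'u) module \<Rightarrow>
    ('v \<Rightarrow> 'w \<Rightarrow> 'u) \<Rightarrow> bool" where
  "bilin V W U B \<longleftrightarrow> (\<forall>x\<in>carrier V. lin_on W U (\<lambda>y. B x y)) \<and>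
     (\<forall>y\<in>carrier W. lin_on V U (\<lambda>x. B x y))"

lemma bilinI:
  assumes "\<And>x. x \<in> carrier V \<Longrightarrow> lin_on W U (\<lambda>y. B x y)"
    and "\<And>y. y \<in> carrier W \<Longrightarrow> lin_on V U (\<lambda>x. B x y)"
  shows "bilin V W U B"
  using assms by (simp add: bilin_def)

lemma bilinD:
  assumes "bilin V W U B"
  shows "x \<in> carrier V \<Longrightarrow> lin_on W U (\<lambda>y. B x y)"
    and "y \<in> carrier W \<Longrightarrow> lin_on V U (\<lambda>x. B x y)"
    and "x \<in> carrier V \<Longrightarrow> y \<in> carrier W \<Longrightarrow> B x y \<in> carrier U"
  using assms lin_onD(1) by (auto simp: bilin_def intro: lin_onD(1))

lemma pure_gen: "pure V W x y = gen (bilinear_rels V W) (x, y)"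
  by (simp add: pure_def gen_def)

lemma kspace_tensor: "kspace (tensor V W)"
  by (simp add: tensor_def kspace_presented)

lemma pure_closed: "x \<in> carrier V \<Longrightarrow> y \<in> carrier W \<Longrightarrow> pure V W x y \<in> carrier (tensor V W)"
  by (simp add: pure_gen tensor_def gen_closed)

lemma one_tensor: "\<one>\<^bsub>tensor V W\<^esub> = pure V W \<one>\<^bsub>V\<^esub> \<one>\<^bsub>W\<^esub>"
  by (simp add: tensor_def presented_one pure_def)

lemma lin_on_tensor_eqI:
  assumes "kspace U" "lin_on (tensor V W) U f" "lin_on (tensor V W) U g"
    and "\<And>x y. x \<in> carrier V \<Longrightarrow> y \<in> carrier W \<Longrightarrow> f (pure V W x y) = g (pure V W x y)"
    and "z \<in> carrier (tensor V W)"
  shows "f z = g z"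
  using lin_on_presented_eqI [of U "V \<times>\<times> W" "bilinear_rels V W" f g z] assms
  by (auto simp: tensor_def pure_gen)

locale two_kspaces = V: kspace V + W: kspace W
  for V :: "('k::field, 'v) module" and W :: "('k, 'w) module"
begin

lemma bilinear_rels_supp: "bilinear_rels V W \<subseteq> supp_on (carrier V \<times> carrier W)"
  by (auto simp: bilinear_rels_def intro!: supp_on_intros)

lemma bilinear_rels_cases:
  assumes "r \<in> bilinear_rels V W"
  obtains x x' y where "x \<in> carrier V" "x' \<in> carrier V" "y \<in> carrier W"
      "r = Poly_Mapping.single (x \<oplus>\<^bsub>V\<^esub> x', y) 1
         - (Poly_Mapping.single (x, y) 1 + Poly_Mapping.single (x', y) 1)"
    | x y y' where "x \<in> carrier V" "y \<in> carrier W" "y' \<in> carrier W"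
      "r = Poly_Mapping.single (x, y \<oplus>\<^bsub>W\<^esub> y') 1
         - (Poly_Mapping.single (x, y) 1 + Poly_Mapping.single (x, y') 1)"
    | x y c where "x \<in> carrier V" "y \<in> carrier W"
      "r = Poly_Mapping.single (c \<odot>\<^bsub>V\<^esub> x, y) 1 - Poly_Mapping.single (x, y) c"
    | x y c where "x \<in> carrier V" "y \<in> carrier W"
      "r = Poly_Mapping.single (x, c \<odot>\<^bsub>W\<^esub> y) 1 - Poly_Mapping.single (x, y) c"
  using assms unfolding bilinear_rels_def
proof (elim UnE CollectE exE conjE, goal_cases)
  case (1 x x' y)
  show ?case by (rule 1(1) [of x x' y]) (use 1(5-) in \<open>simp_all add: diff_diff_eq\<close>)
next
  case (2 x y y')
  show ?case by (rule 2(2) [of x y y']) (use 2(5-) in \<open>simp_all add: diff_diff_eq\<close>)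
next
  case (3 c x y)
  show ?case by (rule 3(3) [of x y c]) (use 3(5-) in simp_all)
next
  case (4 c x y)
  show ?case by (rule 4(4) [of x y c]) (use 4(5-) in simp_all)
qed

lemma bilinear_relsI:
  "x \<in> carrier V \<Longrightarrow> x' \<in> carrier V \<Longrightarrow> y \<in> carrier W \<Longrightarrow>
    Poly_Mapping.single (x \<oplus>\<^bsub>V\<^esub> x', y) 1
      - (Poly_Mapping.single (x, y) 1 + Poly_Mapping.single (x', y) 1) \<in> bilinear_rels V W"
  "x \<in> carrier V \<Longrightarrow> y \<in> carrier W \<Longrightarrow> y' \<in> carrier W \<Longrightarrow>
    Poly_Mapping.single (x, y \<oplus>\<^bsub>W\<^esub> y') 1
      - (Poly_Mapping.single (x, y) 1 + Poly_Mapping.single (x, y') 1) \<in> bilinear_rels V W"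
  "x \<in> carrier V \<Longrightarrow> y \<in> carrier W \<Longrightarrow>
    Poly_Mapping.single (c \<odot>\<^bsub>V\<^esub> x, y) 1 - Poly_Mapping.single (x, y) c \<in> bilinear_rels V W"
  "x \<in> carrier V \<Longrightarrow> y \<in> carrier W \<Longrightarrow>
    Poly_Mapping.single (x, c \<odot>\<^bsub>W\<^esub> y) 1 - Poly_Mapping.single (x, y) c \<in> bilinear_rels V W"
  unfolding bilinear_rels_def diff_diff_eq [symmetric]
  by (rule UnI1, rule UnI1, rule UnI1, blast) (rule UnI1, rule UnI1, rule UnI2, blast,
      rule UnI1, rule UnI2, blast, rule UnI2, blast)

lemma bilin_pure: "bilin V W (tensor V W) (pure V W)"
  by (intro bilinI lin_onI)
    (simp_all add: pure_closed, simp_all add: pure_def tensor_def cls_eq_iff bilinear_relsI pm.span_base)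

lemma bilin_kills_rels:
  assumes U: "kspace U" and B: "bilin V W U B" and r: "r \<in> bilinear_rels V W"
  shows "ev U (\<lambda>(x, y). B x y) r = \<zero>\<^bsub>U\<^esub>"
proof -
  interpret U: kspace U by fact
  let ?X = "carrier V \<times> carrier W"
  have B_closed: "(case m of (x, y) \<Rightarrow> B x y) \<in> carrier U" if "m \<in> ?X" for m
    using that bilinD(3) [OF B] by auto
  note ev = U.ev_single [of ?X "\<lambda>(x, y). B x y", OF B_closed]
    U.ev_add [of ?X "\<lambda>(x, y). B x y", OF B_closed]
    U.ev_diff_eq_zero_iff [of ?X "\<lambda>(x, y). B x y", OF B_closed]
  from r show ?thesis
    by (cases rule: bilinear_rels_cases)
      (simp_all add: ev supp_on_intros bilinD(3) [OF B] lin_onD [OF bilinD(1) [OF B]]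
        lin_onD [OF bilinD(2) [OF B]])
qed

lemma lin_ext_tensor:
  assumes U: "kspace U" and B: "bilin V W U B"
  shows "lin_on (tensor V W) U (lin_ext U (\<lambda>(x, y). B x y))"
    and "x \<in> carrier V \<Longrightarrow> y \<in> carrier W \<Longrightarrow> lin_ext U (\<lambda>(x, y). B x y) (pure V W x y) = B x y"
proof -
  have "bilinear_rels V W \<subseteq> supp_on (carrier (V \<times>\<times> W))"
    using bilinear_rels_supp by simp
  note * = lin_ext_presented [OF U this, of "\<lambda>(x, y). B x y"]
  show "lin_on (tensor V W) U (lin_ext U (\<lambda>(x, y). B x y))"
    unfolding tensor_def using bilinD(3) [OF B] bilin_kills_rels [OF U B] by (intro *) auto
  show "lin_ext U (\<lambda>(x, y). B x y) (pure V W x y) = B x y" if "x \<in> carrier V" "y \<in> carrier W"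
    unfolding pure_gen using bilinD(3) [OF B] bilin_kills_rels [OF U B] that by (subst *) auto
qed

end

lemma bilin_comp:
  assumes "bilin V' W' U B" "lin_on V V' f" "lin_on W W' g"
  shows "bilin V W U (\<lambda>x y. B (f x) (g y))"
  using assms by (auto simp: bilin_def lin_on_def)

lemma tensor_map:
  assumes "kspace V" "kspace W" "kspace V'" "kspace W'" and f: "lin_on V V' f" and g: "lin_on W W' g"
  shows tensor_map_lin: "lin_on (tensor V W) (tensor V' W') (tensor_map V' W' f g)"
    and tensor_map_pure: "x \<in> carrier V \<Longrightarrow> y \<in> carrier W \<Longrightarrow>
      tensor_map V' W' f g (pure V W x y) = pure V' W' (f x) (g y)"
proof -
  interpret VW: two_kspaces V W using assms by (simp add: two_kspaces_def)
  interpret VW': two_kspaces V' W' using assms by (simp add: two_kspaces_def)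
  note * = VW.lin_ext_tensor [OF kspace_tensor bilin_comp [OF VW'.bilin_pure f g]]
  show "lin_on (tensor V W) (tensor V' W') (tensor_map V' W' f g)"
    using *(1) by (simp add: tensor_map_def)
  show "x \<in> carrier V \<Longrightarrow> y \<in> carrier W \<Longrightarrow>
      tensor_map V' W' f g (pure V W x y) = pure V' W' (f x) (g y)"
    using *(2) by (simp add: tensor_map_def)
qed

lemma tensor_ground:
  assumes "kspace V"
  shows tensor_ground_lin: "lin_on (tensor V \<bbbK>) V (tensor_ground V)"
    and tensor_ground_pure: "x \<in> carrier V \<Longrightarrow> tensor_ground V (pure V \<bbbK> x c) = c \<odot>\<^bsub>V\<^esub> x"
proof -
  interpret V: kspace V by fact
  interpret VK: two_kspaces V \<bbbK> using assms by (simp add: two_kspaces_def kspace_ground)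
  have "bilin V \<bbbK> V (\<lambda>x c. c \<odot>\<^bsub>V\<^esub> x)"
    by (intro bilinI lin_onI)
      (auto simp: V.smult_add_left V.smult_add_right V.smult_smult mult.commute)
  note * = VK.lin_ext_tensor [OF assms this]
  show "lin_on (tensor V \<bbbK>) V (tensor_ground V)"
    using *(1) by (simp add: tensor_ground_def)
  show "x \<in> carrier V \<Longrightarrow> tensor_ground V (pure V \<bbbK> x c) = c \<odot>\<^bsub>V\<^esub> x"
    using *(2) by (simp add: tensor_ground_def)
qed

locale two_kalgs = V: kalg V + W: kalg W
  for V :: "('k::field, 'v) module" and W :: "('k, 'w) module"

sublocale two_kalgs \<subseteq> two_kspaces ..

context two_kalgs
begin

text \<open>By bilinearity of the two products, multiplying a bilinearity relation by a pure tensor yields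
  another bilinearity relation.\<close>

lemma presented_kalg_tensor: "presented_kalg (V \<times>\<times> W) (bilinear_rels V W)"
proof
  fix m r assume m: "m \<in> carrier (V \<times>\<times> W)" and r: "r \<in> bilinear_rels V W"
  obtain a b where ab: "m = (a, b)" "a \<in> carrier V" "b \<in> carrier W" using m by auto
  have "mult_pm (V \<times>\<times> W) (Poly_Mapping.single m 1) r \<in> bilinear_rels V W"
    using r by (cases rule: bilinear_rels_cases)
      (simp_all add: ab mult_pm_diff_right mult_pm_add_right bilinear_relsI
        V.mult_add_right W.mult_add_right V.mult_smult_right W.mult_smult_right)
  then show "mult_pm (V \<times>\<times> W) (Poly_Mapping.single m 1) r \<in> span_pm (bilinear_rels V W)"
    by (rule pm.span_base)
  have "mult_pm (V \<times>\<times> W) r (Poly_Mapping.single m 1) \<in> bilinear_rels V W"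
    using r by (cases rule: bilinear_rels_cases)
      (simp_all add: ab mult_pm_diff_left mult_pm_add_left bilinear_relsI
        V.mult_add_left W.mult_add_left V.mult_smult_left W.mult_smult_left)
  then show "mult_pm (V \<times>\<times> W) r (Poly_Mapping.single m 1) \<in> span_pm (bilinear_rels V W)"
    by (rule pm.span_base)
qed (use bilinear_rels_supp in \<open>auto simp: V.mult_unit W.mult_unit\<close>)

lemma kalg_tensor: "kalg (tensor V W)"
  unfolding tensor_def by (rule presented_kalg.kalg_presented [OF presented_kalg_tensor])

lemma pure_mult: "x \<in> carrier V \<Longrightarrow> y \<in> carrier W \<Longrightarrow> x' \<in> carrier V \<Longrightarrow> y' \<in> carrier W \<Longrightarrow>
    pure V W x y \<otimes>\<^bsub>tensor V W\<^esub> pure V W x' y' = pure V W (x \<otimes>\<^bsub>V\<^esub> x') (y \<otimes>\<^bsub>W\<^esub> y')"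
  using presented_kalg.gen_mult [OF presented_kalg_tensor, of "(x, y)" "(x', y')"]
  by (simp add: tensor_def pure_gen)

end


section \<open>Connected components of a set of positions\<close>

lemma componentsE:
  assumes "J \<in> components U"
  obtains l u where "l \<le> u" "J = {l..u}" "{l..u} \<subseteq> U"
    "\<And>l' u'. {l..u} \<subseteq> {l'..u'} \<Longrightarrow> {l'..u'} \<subseteq> U \<Longrightarrow> {l'..u'} = {l..u}"
proof -
  from assms obtain l u where lu: "l \<le> u" "J = {l..u}"
    unfolding components_def by auto
  show thesis
    by (rule that [OF lu]) (use assms lu in \<open>auto simp: components_def simp del: atLeastatMost_subset_iff\<close>)
qed

lemma components_subset: "J \<in> components U \<Longrightarrow> J \<subseteq> U"
  and components_nonempty: "J \<in> components U \<Longrightarrow> J \<noteq> {}"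
  and components_finite: "J \<in> components U \<Longrightarrow> finite J"
  by (auto elim!: componentsE)

lemma components_empty [simp]: "components {} = {}"
  using components_subset components_nonempty by blast

text \<open>The union of two intervals with a common point is an interval, so by maximality both equal it.\<close>

lemma components_unique:
  assumes J: "J \<in> components U" and J': "J' \<in> components U" and i: "i \<in> J" "i \<in> J'"
  shows "J = J'"
proof -
  from J obtain l u where J: "J = {l..u}" "{l..u} \<subseteq> U"
    "\<And>l' u'. {l..u} \<subseteq> {l'..u'} \<Longrightarrow> {l'..u'} \<subseteq> U \<Longrightarrow> {l'..u'} = {l..u}"
    by (elim componentsE) metis
  from J' obtain l' u' where J': "J' = {l'..u'}" "{l'..u'} \<subseteq> U"
    "\<And>a b. {l'..u'} \<subseteq> {a..b} \<Longrightarrow> {a..b} \<subseteq> U \<Longrightarrow> {a..b} = {l'..u'}"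
    by (elim componentsE) metis
  have "{min l l'..max u u'} = {l..u} \<union> {l'..u'}" using i J(1) J'(1) by auto
  then have "{min l l'..max u u'} = {l..u}" "{min l l'..max u u'} = {l'..u'}"
    using J(2) J'(2) by (intro J(3) J'(3); simp)+
  then show ?thesis unfolding J(1) J'(1) by (rule trans [OF sym])
qed

text \<open>A maximal one among the finitely many intervals in \<open>U\<close> through \<open>i\<close> is a component.\<close>

lemma components_cover:
  assumes U: "finite U" and i: "i \<in> U"
  shows "\<exists>J\<in>components U. i \<in> J"
proof -
  define F where "F = {J. (\<exists>l u. l \<le> u \<and> J = {l..u}) \<and> J \<subseteq> U \<and> i \<in> J}"
  have "finite F"
    by (rule finite_subset [of _ "Pow U"]) (auto simp: F_def U)
  moreover have "{i..i} \<in> F" unfolding F_def using i by (auto intro!: exI [of _ i])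
  ultimately obtain J where J: "J \<in> F" "\<And>K. K \<in> F \<Longrightarrow> J \<subseteq> K \<Longrightarrow> J = K"
    using finite_has_maximal [of F] by blast
  have "J \<in> components U"
    unfolding components_def
  proof (intro CollectI conjI allI impI)
    fix l u assume *: "J \<subseteq> {l..u} \<and> {l..u} \<subseteq> U"
    then have "{l..u} \<in> F" using J(1) unfolding F_def by force
    then show "{l..u} = J" using J(2) * by blast
  qed (use J(1) in \<open>auto simp: F_def\<close>)
  then show ?thesis using J(1) by (auto simp: F_def)
qed

lemma finite_components: "finite U \<Longrightarrow> finite (components U)"
  by (rule finite_subset [of _ "Pow U"]) (auto dest: components_subset)

text \<open>An interval separated from \<open>U\<close> by at least one missing point forms a component of its own: an
  interval meeting both would contain the missing point \<open>l - 1\<close>. This is what makes sums over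
  subsets computable one letter at a time.\<close>

lemma components_insert_interval:
  assumes U: "\<And>x. x \<in> U \<Longrightarrow> Suc x < l" and lu: "l \<le> u"
  shows "components (U \<union> {l..u}) = insert {l..u} (components U)"
proof -
  have no_gap: "l - 1 \<notin> U \<union> {l..u}" if "l > 0"
    using U [of "l - 1"] that by auto
  have interval: "{l..u} \<in> components (U \<union> {l..u})"
    unfolding components_def
  proof (intro CollectI conjI allI impI)
    fix a b assume *: "{l..u} \<subseteq> {a..b} \<and> {a..b} \<subseteq> U \<union> {l..u}"
    then have ab: "a \<le> l" "u \<le> b" using lu by auto
    have "a = l"
    proof (rule ccontr)
      assume "a \<noteq> l"
      then have "l - 1 \<in> {a..b}" "l > 0" using ab lu by auto
      then show False using * no_gap by blast
    qed
    moreover have "b \<in> {a..b}" using ab lu by simp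
    then have "b \<in> U \<union> {l..u}" using * by blast
    then have "b \<le> u" using U [of b] ab lu by fastforce
    ultimately show "{a..b} = {l..u}" using ab by auto
  qed (use lu in blast)+
  show ?thesis
  proof (intro subset_antisym subsetI)
    fix J assume J: "J \<in> components (U \<union> {l..u})"
    show "J \<in> insert {l..u} (components U)"
    proof (cases "J \<inter> {l..u} = {}")
      case False
      then show ?thesis using components_unique [OF J interval] by auto
    next
      case True
      then have "J \<subseteq> U" using components_subset [OF J] by auto
      then show ?thesis using J unfolding components_def by blast
    qed
  next
    fix J assume J: "J \<in> insert {l..u} (components U)"
    show "J \<in> components (U \<union> {l..u})"
    proof (cases "J = {l..u}")
      case False
      then have J': "J \<in> components U" using J by simp
      show ?thesis
        unfolding components_def
      proof (intro CollectI conjI allI impI)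
        fix a b assume *: "J \<subseteq> {a..b} \<and> {a..b} \<subseteq> U \<union> {l..u}"
        obtain x where x: "x \<in> J" using components_nonempty [OF J'] by auto
        then have xl: "Suc x < l" using components_subset [OF J'] U by auto
        have "{a..b} \<subseteq> U"
        proof (rule ccontr)
          assume "\<not> {a..b} \<subseteq> U"
          then obtain y where "y \<in> {a..b}" "y \<notin> U" by blast
          moreover from this have "y \<in> {l..u}" using * by blast
          ultimately have "y \<in> {a..b}" "y \<ge> l" by simp_all
          then have "l - 1 \<in> {a..b}" "l > 0" using * x xl by auto
          then show False using * no_gap by blast
        qed
        then show "{a..b} = J" using J' * unfolding components_def by blast
      qed (use J' in \<open>auto simp: components_def\<close>)
    qed (use interval in simp)
  qed
qed

lemma (in linorder) sorted_key_list_of_set_inj_on: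
  assumes "finite A" and inj: "inj_on f A"
  shows "set (sorted_key_list_of_set f A) = A" "distinct (sorted_key_list_of_set f A)"
proof -
  interpret folding_insort_key "(\<le>)" "(<)" A f
    by unfold_locales (rule inj)
  show "set (sorted_key_list_of_set f A) = A" "distinct (sorted_key_list_of_set f A)"
    using \<open>finite A\<close> distinct_sorted_key_list_of_set [of A] by (simp_all add: distinct_map)
qed

lemma component_list:
  assumes "finite U"
  shows set_component_list: "set (component_list U) = components U"
    and distinct_component_list: "distinct (component_list U)"
proof -
  have "inj_on Min (components U)"
  proof (rule inj_onI)
    fix J K assume *: "J \<in> components U" "K \<in> components U" "Min J = Min K"
    then have "Min J \<in> J" "Min J \<in> K"
      using Min_in components_finite components_nonempty by metis+
    then show "J = K" using components_unique * by blast
  qed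
  from sorted_key_list_of_set_inj_on [OF finite_components [OF assms] this]
  show "set (component_list U) = components U" "distinct (component_list U)"
    by (simp_all add: component_list_def)
qed

lemma nths_middle:
  "nths (u @ [x] @ v) I =
    nths u I @ (if length u \<in> I then [x] else []) @ nths v {j. Suc (j + length u) \<in> I}"
  by (simp add: nths_append nths_Cons)

lemma nths_in_lists: "w \<in> lists X \<Longrightarrow> nths w I \<in> lists X"
  by (auto dest: in_set_nthsD)

lemma nths_nonempty:
  assumes "I \<subseteq> {..<length w}" "I \<noteq> {}"
  shows "nths w I \<noteq> []"
proof -
  have "length (nths w I) = card I"
    using assms(1) by (auto simp: length_nths intro!: arg_cong [of _ _ card])
  moreover have "finite I" using assms(1) finite_subset by blast
  ultimately show ?thesis using assms(2) by auto
qed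

definition gap_words :: "'v list \<Rightarrow> nat set \<Rightarrow> 'v list list" where
  "gap_words w S = map (nths w) (component_list ({..<length w} - S))"

lemma gap_words_in_lists:
  assumes "w \<in> lists X"
  shows "gap_words w S \<in> lists (lists X - {[]})"
proof -
  have "nths w J \<in> lists X - {[]}" if "J \<in> components ({..<length w} - S)" for J
    using components_subset [OF that] components_nonempty [OF that] nths_nonempty [of J w]
      nths_in_lists [OF assms] by auto
  then show ?thesis
    by (intro in_listsI ballI) (auto simp: gap_words_def set_component_list simp del: in_lists_conv_set)
qed

text \<open>Fix a position. It lies in \<open>S\<close>, and then only the subword of \<open>S\<close> depends on the letter there; or it lies
  in exactly one component of the complement, and then only the corresponding entry of the list of
  gap words does. In both cases linearity in the letter reduces to linearity of \<open>P\<close> in a letter of a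
  single argument.\<close>

lemma multilin_split:
  assumes V: "kspace V" and U: "kspace U"
    and closed: "\<And>s Js. s \<in> lists (carrier V) \<Longrightarrow> Js \<in> lists (lists (carrier V) - {[]}) \<Longrightarrow>
      P s Js \<in> carrier U"
    and lin_word: "\<And>u v Js. u \<in> lists (carrier V) \<Longrightarrow> v \<in> lists (carrier V) \<Longrightarrow>
      Js \<in> lists (lists (carrier V) - {[]}) \<Longrightarrow> lin_on V U (\<lambda>x. P (u @ [x] @ v) Js)"
    and lin_gap: "\<And>u v s Js Ks. u \<in> lists (carrier V) \<Longrightarrow> v \<in> lists (carrier V) \<Longrightarrow>
      s \<in> lists (carrier V) \<Longrightarrow> Js \<in> lists (lists (carrier V) - {[]}) \<Longrightarrow>
      Ks \<in> lists (lists (carrier V) - {[]}) \<Longrightarrow> lin_on V U (\<lambda>x. P s (Js @ [u @ [x] @ v] @ Ks))"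
  shows "multilin V U (\<lambda>w. P (nths w S) (gap_words w S))"
proof (rule multilinI)
  show "P (nths w S) (gap_words w S) \<in> carrier U" if "w \<in> lists (carrier V)" for w
    by (intro closed gap_words_in_lists nths_in_lists that)
next
  fix u v assume u: "u \<in> lists (carrier V)" and v: "v \<in> lists (carrier V)"
  interpret V: kspace V by fact
  \<comment> \<open>For every set \<open>I\<close> of positions, \<open>left I\<close> and \<open>right I\<close> are the parts of the subword of \<open>I\<close> before and
  after the distinguished position; neither depends on the letter there.\<close>
  define left where "left I = nths u I" for I
  define right where "right I = nths v {j. Suc (j + length u) \<in> I}" for I
  have left: "left I \<in> lists (carrier V)" and right: "right I \<in> lists (carrier V)" for I
    unfolding left_def right_def by (intro nths_in_lists u v)+
  have nths_in: "nths (u @ [x] @ v) I = left I @ [x] @ right I" if "length u \<in> I" for x I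
    using that unfolding nths_middle left_def right_def by simp
  have nths_out: "nths (u @ [x] @ v) I = left I @ right I" if "length u \<notin> I" for x I
    using that unfolding nths_middle left_def right_def by simp
  define U' where "U' = {..<length (u @ [\<zero>\<^bsub>V\<^esub>] @ v)} - S"
  have fin: "finite U'" by (simp add: U'_def)
  have gap: "gap_words (u @ [x] @ v) S = map (nths (u @ [x] @ v)) (component_list U')" for x
    by (simp add: gap_words_def U'_def)
  have gap_nonempty: "set (component_list U') \<subseteq> {J. J \<subseteq> U' \<and> J \<noteq> {}}"
    using components_subset components_nonempty by (auto simp: set_component_list [OF fin])
  have pieces: "map (\<lambda>J. left J @ right J) Js \<in> lists (lists (carrier V) - {[]})"
    if Js: "set Js \<subseteq> set (component_list U')" and avoid: "\<And>J. J \<in> set Js \<Longrightarrow> length u \<notin> J" for Js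
  proof -
    have "left J @ right J \<noteq> []" if J: "J \<in> set Js" for J
    proof -
      have "nths (u @ [\<zero>\<^bsub>V\<^esub>] @ v) J \<noteq> []"
        using gap_nonempty J Js by (intro nths_nonempty) (auto simp: U'_def)
      then show ?thesis by (simp only: nths_out [OF avoid [OF J]] not_False_eq_True)
    qed
    moreover have "left J @ right J \<in> lists (carrier V)" for J
      using left right by simp
    ultimately show ?thesis
      by (intro in_listsI ballI) (auto simp del: in_lists_conv_set append_in_lists_conv)
  qed
  show "lin_on V U (\<lambda>x. P (nths (u @ [x] @ v) S) (gap_words (u @ [x] @ v) S))"
  proof (cases "length u \<in> S")
    case True
    then have out: "length u \<notin> J" if "J \<in> set (component_list U')" for J
      using gap_nonempty that by (auto simp: U'_def)
    have "gap_words (u @ [x] @ v) S = map (\<lambda>J. left J @ right J) (component_list U')" for x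
      unfolding gap using out nths_out by (intro map_cong) auto
    then show ?thesis
      using lin_word [OF left right pieces] out by (simp add: nths_in [OF True] del: append.simps)
  next
    case False
    then have "length u \<in> U'" by (simp add: U'_def)
    then obtain J where J: "J \<in> set (component_list U')" "length u \<in> J"
      using components_cover [OF fin] set_component_list [OF fin] by blast
    obtain Js Ks where split: "component_list U' = Js @ J # Ks"
      using J(1) by (meson split_list)
    have out: "length u \<notin> K" if "K \<in> set Js \<union> set Ks" for K
    proof
      assume "length u \<in> K"
      then have "K = J"
        using that J split components_unique set_component_list [OF fin] by (metis Un_iff in_set_conv_decomp
            list.set_intros(2) set_append)
      then show False using that distinct_component_list [OF fin] split by auto
    qed
    have "gap_words (u @ [x] @ v) S = map (\<lambda>J. left J @ right J) Js @ [left J @ [x] @ right J]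
        @ map (\<lambda>J. left J @ right J) Ks" for x
      unfolding gap split using out nths_out nths_in [OF J(2)] by auto
    moreover have "lin_on V U (\<lambda>x. P (left S @ right S) (map (\<lambda>J. left J @ right J) Js
        @ [left J @ [x] @ right J] @ map (\<lambda>J. left J @ right J) Ks))"
      by (rule lin_gap [OF left right _ pieces pieces]) (use out split left right in auto)
    ultimately show ?thesis
      by (simp only: nths_out [OF False])
  qed
qed

lemma multilin_finsum:
  assumes V: "kspace V" and U: "kspace U" and F: "\<And>S. multilin V U (F S)" and I: "\<And>n. finite (I n)"
  shows "multilin V U (\<lambda>w. \<Oplus>\<^bsub>U\<^esub>S\<in>I (length w). F S w)"
proof -
  interpret V: kspace V by fact
  interpret U: kspace U by fact
  note closed = multilinD(1) [OF F]
  show ?thesis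
  proof (rule multilinI)
    fix u v assume uv: "u \<in> lists (carrier V)" "v \<in> lists (carrier V)"
    note lin = lin_onD [OF multilinD(2) [OF F uv]]
    define K where "K = I (Suc (length u + length v))"
    have K: "finite K" "I (length (u @ [x] @ v)) = K" for x by (simp_all add: K_def I)
    show "lin_on V U (\<lambda>x. \<Oplus>\<^bsub>U\<^esub>S\<in>I (length (u @ [x] @ v)). F S (u @ [x] @ v))"
      unfolding K(2)
    proof (rule lin_onI)
      fix x y assume xy: "x \<in> carrier V" "y \<in> carrier V"
      have "(\<Oplus>\<^bsub>U\<^esub>S\<in>K. F S (u @ [x \<oplus>\<^bsub>V\<^esub> y] @ v)) =
          (\<Oplus>\<^bsub>U\<^esub>S\<in>K. F S (u @ [x] @ v) \<oplus>\<^bsub>U\<^esub> F S (u @ [y] @ v))"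
        using xy lin by (intro U.finsum_cong') (auto simp del: append.simps)
      also have "\<dots> = (\<Oplus>\<^bsub>U\<^esub>S\<in>K. F S (u @ [x] @ v)) \<oplus>\<^bsub>U\<^esub> (\<Oplus>\<^bsub>U\<^esub>S\<in>K. F S (u @ [y] @ v))"
        using xy lin(1) by (intro U.finsum_addf) (auto simp del: append.simps)
      finally show "(\<Oplus>\<^bsub>U\<^esub>S\<in>K. F S (u @ [x \<oplus>\<^bsub>V\<^esub> y] @ v)) =
          (\<Oplus>\<^bsub>U\<^esub>S\<in>K. F S (u @ [x] @ v)) \<oplus>\<^bsub>U\<^esub> (\<Oplus>\<^bsub>U\<^esub>S\<in>K. F S (u @ [y] @ v))" .
    next
      fix c x assume x: "x \<in> carrier V"
      have "(\<Oplus>\<^bsub>U\<^esub>S\<in>K. F S (u @ [c \<odot>\<^bsub>V\<^esub> x] @ v)) = (\<Oplus>\<^bsub>U\<^esub>S\<in>K. c \<odot>\<^bsub>U\<^esub> F S (u @ [x] @ v))"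
        using x lin by (intro U.finsum_cong') (auto simp del: append.simps)
      also have "\<dots> = c \<odot>\<^bsub>U\<^esub> (\<Oplus>\<^bsub>U\<^esub>S\<in>K. F S (u @ [x] @ v))"
        using x lin(1) K(1) by (intro U.finsum_smult [symmetric]) (auto simp del: append.simps)
      finally show "(\<Oplus>\<^bsub>U\<^esub>S\<in>K. F S (u @ [c \<odot>\<^bsub>V\<^esub> x] @ v)) = c \<odot>\<^bsub>U\<^esub> (\<Oplus>\<^bsub>U\<^esub>S\<in>K. F S (u @ [x] @ v))" .
    qed (use lin(1) in \<open>auto intro!: U.finsum_closed simp del: append.simps\<close>)
  qed (use closed in \<open>auto intro!: U.finsum_closed simp del: in_lists_conv_set\<close>)
qed


section \<open>Sums over subwords weighted by gaps\<close>

text \<open>The sum \<open>\<Sum>\<^sub>S (\<Prod>\<^sub>J \<phi>(a\<^sub>J)) L(a\<^sub>S)\<close> over the subsets \<open>S\<close> of the positions of \<open>w\<close>, where the components \<open>J\<close>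
  are taken in the longer word \<open>w @ q\<close>: no position of \<open>q\<close> belongs to \<open>S\<close>, so \<open>q\<close> is glued to the
  last gap. The case of interest is \<open>q = []\<close>; a general \<open>q\<close> is the state that is carried along when
  \<open>w\<close> is read from its last letter.\<close>

definition gapsum :: "('k::field, 'w) module \<Rightarrow> ('b list \<Rightarrow> 'k) \<Rightarrow> ('b list \<Rightarrow> 'w) \<Rightarrow> 'b list \<Rightarrow> 'b list \<Rightarrow> 'w" where
  "gapsum W \<phi> L w q = (\<Oplus>\<^bsub>W\<^esub>S\<in>Pow {..<length w}.
     (\<Prod>J\<in>components ({..<length w + length q} - S). \<phi> (nths (w @ q) J)) \<odot>\<^bsub>W\<^esub> L (nths w S))"

context kspace
begin

lemma gapsum_closed [simp]: "(\<And>u. L u \<in> carrier W) \<Longrightarrow> gapsum W \<phi> L w q \<in> carrier W"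
  unfolding gapsum_def by (rule finsum_closed) auto

lemma gapsum_Nil:
  assumes L: "\<And>u. L u \<in> carrier W" and \<phi>: "\<phi> [] = 1"
  shows "gapsum W \<phi> L [] q = \<phi> q \<odot> L []"
proof (cases "q = []")
  case True
  then show ?thesis using L \<phi> by (simp add: gapsum_def)
next
  case False
  then have "{..<length q} = {} \<union> {0..length q - 1}" by (cases q) auto
  then have "components {..<length q} = {{..<length q}}"
    using components_insert_interval [of "{}" 0 "length q - 1"] by simp
  then show ?thesis using L by (simp add: gapsum_def nths_all)
qed

text \<open>The two terms collect the subsets \<open>S\<close> without and with the last position of \<open>w\<close>. In the first case
  the letter \<open>a\<close> joins the last gap; in the second it closes that gap, whose factor \<open>\<phi> q\<close> splits off,
  and a new empty gap is opened before it. For \<open>q = []\<close> no component is split off, which is consistent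
  because \<open>\<phi> [] = 1\<close>.\<close>

lemma gapsum_snoc:
  assumes L: "\<And>u. L u \<in> carrier W" and \<phi>: "\<phi> [] = 1"
  shows "gapsum W \<phi> L (w @ [a]) q =
    gapsum W \<phi> L w (a # q) \<oplus> \<phi> q \<odot> gapsum W \<phi> (\<lambda>u. L (u @ [a])) w []"
proof -
  define n where "n = length w"
  define T where "T S = (\<Prod>J\<in>components ({..<Suc n + length q} - S).
     \<phi> (nths ((w @ [a]) @ q) J)) \<odot> L (nths (w @ [a]) S)" for S
  have T: "T S \<in> carrier W" for S using L by (simp add: T_def)
  have Pow: "Pow {..<Suc n} = Pow {..<n} \<union> insert n ` Pow {..<n}"
    by (simp add: lessThan_Suc Pow_insert)
  have "gapsum W \<phi> L (w @ [a]) q = (\<Oplus>S\<in>Pow {..<Suc n}. T S)"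
    by (simp add: gapsum_def T_def n_def)
  also have "\<dots> = (\<Oplus>S\<in>Pow {..<n}. T S) \<oplus> (\<Oplus>S\<in>insert n ` Pow {..<n}. T S)"
    unfolding Pow by (rule finsum_Un_disjoint) (use T in auto)
  also have "(\<Oplus>S\<in>insert n ` Pow {..<n}. T S) = (\<Oplus>S\<in>Pow {..<n}. T (insert n S))"
  proof (rule finsum_reindex)
    show "inj_on (insert n) (Pow {..<n})"
      by (rule inj_onI) (metis Pow_iff insert_ident lessThan_iff less_irrefl subsetD)
  qed (use T in auto)
  also have "(\<Oplus>S\<in>Pow {..<n}. T S) = gapsum W \<phi> L w (a # q)"
    unfolding gapsum_def
  proof (rule finsum_cong')
    fix S assume "S \<in> Pow {..<length w}"
    then have "nths (w @ [a]) S = nths w S" by (auto simp: nths_append)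
    then show "T S = (\<Prod>J\<in>components ({..<length w + length (a # q)} - S).
        \<phi> (nths (w @ a # q) J)) \<odot> L (nths w S)"
      by (simp add: T_def n_def)
  qed (use L in \<open>auto simp: n_def\<close>)
  also have "(\<Oplus>S\<in>Pow {..<n}. T (insert n S)) = (\<Oplus>S\<in>Pow {..<n}. \<phi> q \<odot>
      ((\<Prod>J\<in>components ({..<n} - S). \<phi> (nths w J)) \<odot> L (nths w S @ [a])))"
  proof (rule finsum_cong')
    fix S assume "S \<in> Pow {..<n}"
    then have S: "S \<subseteq> {..<n}" by simp
    have "nths w (insert n S) = nths w S"
      unfolding nths_def by (intro arg_cong [of _ _ "map fst"] filter_cong) (auto simp: n_def set_zip)
    then have word: "nths (w @ [a]) (insert n S) = nths w S @ [a]"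
      by (simp add: nths_append n_def nths_Cons)
    have prefix: "nths (w @ a # q) J = nths w J" if "J \<in> components ({..<n} - S)" for J
    proof -
      have "{j. j + length w \<in> J} = {}"
        using components_subset [OF that] by (auto simp: n_def)
      then show ?thesis by (simp add: nths_append)
    qed
    have prod: "(\<Prod>J\<in>components ({..<n} - S). \<phi> (nths (w @ a # q) J)) =
        (\<Prod>J\<in>components ({..<n} - S). \<phi> (nths w J))"
      by (intro prod.cong refl) (simp add: prefix)
    have "(\<Prod>J\<in>components ({..<Suc n + length q} - insert n S). \<phi> (nths (w @ a # q) J)) =
        \<phi> q * (\<Prod>J\<in>components ({..<n} - S). \<phi> (nths w J))"
    proof (cases "q = []")
      case True
      then have "{..<Suc n + length q} - insert n S = {..<n} - S" by auto
      then show ?thesis using prod True \<phi> by simp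
    next
      case False
      then have "length q \<noteq> 0" by simp
      then have *: "{..<Suc n + length q} - insert n S = ({..<n} - S) \<union> {Suc n..n + length q}"
        using S by auto
      have comps: "components ({..<Suc n + length q} - insert n S) =
          insert {Suc n..n + length q} (components ({..<n} - S))"
        unfolding * by (rule components_insert_interval) (use \<open>length q \<noteq> 0\<close> in \<open>auto simp: Suc_le_eq\<close>)
      have "{Suc n..n + length q} \<notin> components ({..<n} - S)"
      proof
        assume "{Suc n..n + length q} \<in> components ({..<n} - S)"
        moreover have "Suc n \<in> {Suc n..n + length q}" using \<open>length q \<noteq> 0\<close> by (simp add: Suc_le_eq)
        ultimately have "Suc n \<in> {..<n} - S" using components_subset by blast
        then show False by simp
      qed
      moreover have "nths (w @ a # q) {Suc n..n + length q} = q"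
      proof -
        have "nths w {Suc n..n + length q} = []"
          by (auto simp: n_def filter_empty_conv nths_def set_zip)
        moreover have "nths q {j. Suc j + length w \<in> {Suc n..n + length q}} = q"
          by (rule nths_all) (auto simp: n_def)
        ultimately show ?thesis
          by (simp add: nths_append nths_Cons n_def)
      qed
      ultimately show ?thesis
        unfolding comps using prod by (simp add: finite_components)
    qed
    then show "T (insert n S) = \<phi> q \<odot>
        ((\<Prod>J\<in>components ({..<n} - S). \<phi> (nths w J)) \<odot> L (nths w S @ [a]))"
      using L by (simp add: T_def word smult_smult)
  qed (use L in auto)
  also have "\<dots> = \<phi> q \<odot> gapsum W \<phi> (\<lambda>u. L (u @ [a])) w []"
    using L by (subst finsum_smult [symmetric]) (auto simp: gapsum_def n_def)
  finally show ?thesis .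
qed

lemma gapsum_add:
  assumes "\<And>u. L u \<in> carrier W" "\<And>u. L' u \<in> carrier W"
  shows "gapsum W \<phi> (\<lambda>u. L u \<oplus> L' u) w q = gapsum W \<phi> L w q \<oplus> gapsum W \<phi> L' w q"
  unfolding gapsum_def
  by (subst finsum_addf [symmetric])
    (use assms in \<open>auto simp: smult_add_right intro!: finsum_cong'\<close>)

lemma gapsum_smult:
  assumes "\<And>u. L u \<in> carrier W"
  shows "gapsum W \<phi> (\<lambda>u. c \<odot> L u) w q = c \<odot> gapsum W \<phi> L w q"
  unfolding gapsum_def using assms by (simp add: finsum_smult smult_smult mult.commute)

lemma gapsum_smult_const:
  assumes x: "x \<in> carrier W"
  shows "gapsum W \<phi> (\<lambda>u. c u \<odot> x) w q = gapsum \<bbbK> \<phi> c w q \<odot> x"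
proof -
  interpret K: kspace "\<bbbK> :: ('k, 'k) module" by (rule kspace_ground)
  have "lin_on \<bbbK> W (\<lambda>c. c \<odot> x)"
    using x by (intro lin_onI) (auto simp: smult_add_left smult_smult)
  note hom = lin_on_finsum [OF kspace_ground module_axiom [THEN kspace.intro] this]
  have "gapsum \<bbbK> \<phi> c w q \<odot> x = (\<Oplus>S\<in>Pow {..<length w}.
     ((\<Prod>J\<in>components ({..<length w + length q} - S). \<phi> (nths (w @ q) J)) * c (nths w S)) \<odot> x)"
    unfolding gapsum_def by (subst hom) auto
  then show ?thesis
    unfolding gapsum_def using x by (simp add: smult_smult)
qed

text \<open>The terms are sorted by the last element \<open>i\<close> of \<open>S\<close>; the first summand is the term \<open>S = \<emptyset>\<close>.\<close>

lemma gapsum_expand: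
  assumes L: "\<And>u. L u \<in> carrier W" and \<phi>: "\<phi> [] = 1"
  shows "gapsum W \<phi> L w q = \<phi> (w @ q) \<odot> L [] \<oplus>
    (\<Oplus>i\<in>{..<length w}. \<phi> (drop (Suc i) w @ q) \<odot> gapsum W \<phi> (\<lambda>u. L (u @ [w ! i])) (take i w) [])"
proof (induction w arbitrary: q rule: rev_induct)
  case Nil
  then show ?case using L \<phi> by (simp add: gapsum_Nil)
next
  case (snoc a w)
  let ?t = "\<lambda>i. \<phi> (drop (Suc i) w @ a # q) \<odot> gapsum W \<phi> (\<lambda>u. L (u @ [w ! i])) (take i w) []"
  have "(\<Oplus>i\<in>{..<length (w @ [a])}. \<phi> (drop (Suc i) (w @ [a]) @ q) \<odot>
        gapsum W \<phi> (\<lambda>u. L (u @ [(w @ [a]) ! i])) (take i (w @ [a])) [])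
      = \<phi> q \<odot> gapsum W \<phi> (\<lambda>u. L (u @ [a])) w [] \<oplus> (\<Oplus>i\<in>{..<length w}. \<phi> (drop (Suc i) (w @ [a]) @ q) \<odot>
        gapsum W \<phi> (\<lambda>u. L (u @ [(w @ [a]) ! i])) (take i (w @ [a])) [])"
    using L by (simp add: lessThan_Suc Pi_def)
  also have "(\<Oplus>i\<in>{..<length w}. \<phi> (drop (Suc i) (w @ [a]) @ q) \<odot>
        gapsum W \<phi> (\<lambda>u. L (u @ [(w @ [a]) ! i])) (take i (w @ [a])) []) = (\<Oplus>i\<in>{..<length w}. ?t i)"
    using L by (intro finsum_cong') (auto simp: nth_append)
  finally have sum: "(\<Oplus>i\<in>{..<length (w @ [a])}. \<phi> (drop (Suc i) (w @ [a]) @ q) \<odot>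
        gapsum W \<phi> (\<lambda>u. L (u @ [(w @ [a]) ! i])) (take i (w @ [a])) [])
      = \<phi> q \<odot> gapsum W \<phi> (\<lambda>u. L (u @ [a])) w [] \<oplus> (\<Oplus>i\<in>{..<length w}. ?t i)" .
  have rearrange: "(x \<oplus> y) \<oplus> z = x \<oplus> (z \<oplus> y)"
    if "x \<in> carrier W" "y \<in> carrier W" "z \<in> carrier W" for x y z
    using that by (simp add: a_ac)
  show ?case
    unfolding sum gapsum_snoc [where L = L and \<phi> = \<phi>, OF L \<phi>] snoc.IH append_assoc append.simps
    by (rule rearrange) (use L in \<open>auto intro!: finsum_closed\<close>)
qed

text \<open>Substitution is compatible with cutting at a letter: if a function on words is a sum over cuts
  \<open>u = u' b u''\<close> of \<open>f(u'') G\<^sub>b(u')\<close>, then inserting gaps into \<open>u\<close> amounts to inserting them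
  independently into both parts, because the letter \<open>b\<close> separates the gaps on its left from those on
  its right.\<close>

lemma gapsum_cut:
  assumes f: "\<And>b u. G b u \<in> carrier W" and \<phi>: "\<phi> [] = 1"
  shows "gapsum W \<phi> (\<lambda>u. \<Oplus>i\<in>{..<length u}. f (drop (Suc i) u) \<odot> G (u ! i) (take i u)) w q =
    (\<Oplus>i\<in>{..<length w}. gapsum \<bbbK> \<phi> f (drop (Suc i) w) q \<odot> gapsum W \<phi> (G (w ! i)) (take i w) [])"
proof (induction w arbitrary: f q rule: rev_induct)
  case Nil
  then show ?case using f \<phi> by (subst gapsum_Nil) auto
next
  case (snoc a w)
  interpret K: kspace "\<bbbK> :: ('k, 'k) module" by (rule kspace_ground)
  let ?H = "\<lambda>f u. \<Oplus>i\<in>{..<length u}. f (drop (Suc i) u) \<odot> G (u ! i) (take i u)"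
  let ?g = "\<lambda>i. gapsum W \<phi> (G (w ! i)) (take i w) []"
  have H: "?H f u \<in> carrier W" for f u using f by (intro finsum_closed) auto
  \<comment> \<open>Appending a letter to \<open>u\<close> adds the cut at that letter and prolongs the right part of all other
  cuts, so the induction hypothesis is applied with \<open>f\<close> replaced by \<open>\<lambda>v. f (v @ [a])\<close>.\<close>
  have H_snoc: "?H f (u @ [a]) = ?H (\<lambda>v. f (v @ [a])) u \<oplus> f [] \<odot> G a u" for u
  proof -
    have "?H f (u @ [a]) = f [] \<odot> G a u \<oplus>
        (\<Oplus>i\<in>{..<length u}. f (drop (Suc i) (u @ [a])) \<odot> G ((u @ [a]) ! i) (take i (u @ [a])))"
      using f by (simp add: lessThan_Suc Pi_def)
    also have "(\<Oplus>i\<in>{..<length u}. f (drop (Suc i) (u @ [a])) \<odot> G ((u @ [a]) ! i) (take i (u @ [a])))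
        = ?H (\<lambda>v. f (v @ [a])) u"
      using f by (intro finsum_cong') (auto simp: nth_append)
    finally show ?thesis using f H by (simp add: a_comm)
  qed
  have "gapsum W \<phi> (?H f) (w @ [a]) q =
      gapsum W \<phi> (?H f) w (a # q) \<oplus> \<phi> q \<odot> gapsum W \<phi> (\<lambda>u. ?H (\<lambda>v. f (v @ [a])) u \<oplus> f [] \<odot> G a u) w []"
    by (subst gapsum_snoc [where L = "?H f" and \<phi> = \<phi>, OF H \<phi>]) (simp only: H_snoc)
  also have "gapsum W \<phi> (\<lambda>u. ?H (\<lambda>v. f (v @ [a])) u \<oplus> f [] \<odot> G a u) w [] =
      gapsum W \<phi> (?H (\<lambda>v. f (v @ [a]))) w [] \<oplus> f [] \<odot> gapsum W \<phi> (G a) w []"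
    using H f by (simp add: gapsum_add gapsum_smult)
  also have "gapsum W \<phi> (?H f) w (a # q) =
      (\<Oplus>i\<in>{..<length w}. gapsum \<bbbK> \<phi> f (drop (Suc i) w) (a # q) \<odot> ?g i)"
    by (rule snoc.IH)
  also have "gapsum W \<phi> (?H (\<lambda>v. f (v @ [a]))) w [] =
      (\<Oplus>i\<in>{..<length w}. gapsum \<bbbK> \<phi> (\<lambda>v. f (v @ [a])) (drop (Suc i) w) [] \<odot> ?g i)"
    by (rule snoc.IH)
  finally have lhs: "gapsum W \<phi> (?H f) (w @ [a]) q =
      (\<Oplus>i\<in>{..<length w}. gapsum \<bbbK> \<phi> f (drop (Suc i) w) (a # q) \<odot> ?g i) \<oplus>
      \<phi> q \<odot> ((\<Oplus>i\<in>{..<length w}. gapsum \<bbbK> \<phi> (\<lambda>v. f (v @ [a])) (drop (Suc i) w) [] \<odot> ?g i) \<oplus>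
        f [] \<odot> gapsum W \<phi> (G a) w [])" .
  have "(\<Oplus>i\<in>{..<length (w @ [a])}. gapsum \<bbbK> \<phi> f (drop (Suc i) (w @ [a])) q \<odot>
        gapsum W \<phi> (G ((w @ [a]) ! i)) (take i (w @ [a])) []) =
      (\<phi> q * f []) \<odot> gapsum W \<phi> (G a) w [] \<oplus>
      (\<Oplus>i\<in>{..<length w}. gapsum \<bbbK> \<phi> f (drop (Suc i) (w @ [a])) q \<odot>
        gapsum W \<phi> (G ((w @ [a]) ! i)) (take i (w @ [a])) [])"
    using f \<phi> by (simp add: lessThan_Suc Pi_def K.gapsum_Nil)
  also have "(\<Oplus>i\<in>{..<length w}. gapsum \<bbbK> \<phi> f (drop (Suc i) (w @ [a])) q \<odot>
        gapsum W \<phi> (G ((w @ [a]) ! i)) (take i (w @ [a])) []) =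
      (\<Oplus>i\<in>{..<length w}. gapsum \<bbbK> \<phi> f (drop (Suc i) w) (a # q) \<odot> ?g i \<oplus>
        \<phi> q \<odot> (gapsum \<bbbK> \<phi> (\<lambda>v. f (v @ [a])) (drop (Suc i) w) [] \<odot> ?g i))"
    using f \<phi> by (intro finsum_cong') (auto simp: nth_append K.gapsum_snoc smult_add_left smult_smult)
  also have "\<dots> = (\<Oplus>i\<in>{..<length w}. gapsum \<bbbK> \<phi> f (drop (Suc i) w) (a # q) \<odot> ?g i) \<oplus>
      \<phi> q \<odot> (\<Oplus>i\<in>{..<length w}. gapsum \<bbbK> \<phi> (\<lambda>v. f (v @ [a])) (drop (Suc i) w) [] \<odot> ?g i)"
    using f by (subst finsum_addf) (auto simp: finsum_smult)
  finally show ?case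
    unfolding lhs using f by (simp add: smult_add_right smult_smult a_ac Pi_def)
qed

text \<open>The common source of associativity and of the action law. The inner sum is cut at the last letter
  of \<open>S\<close> (\<open>gapsum_expand\<close>); the outer sum then acts on both parts separately (\<open>gapsum_cut\<close>). On the right
  part it produces the values of \<open>gapsum \<bbbK> \<phi> \<psi>\<close>, and on the left part the claim for a shorter
  word, with \<open>L\<close> replaced by \<open>\<lambda>u. L (u @ [b])\<close>. The result is the expansion of the right-hand side.\<close>

lemma gapsum_gapsum:
  assumes L: "\<And>u. L u \<in> carrier W" and \<phi>: "\<phi> [] = 1" and \<psi>: "\<psi> [] = 1"
  shows "gapsum W \<phi> (\<lambda>u. gapsum W \<psi> L u []) w [] = gapsum W (\<lambda>v. gapsum \<bbbK> \<phi> \<psi> v []) L w []"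
  using L
proof (induction "length w" arbitrary: w L rule: less_induct)
  case less
  interpret K: kspace "\<bbbK> :: ('k, 'k) module" by (rule kspace_ground)
  let ?\<chi> = "\<lambda>v. gapsum \<bbbK> \<phi> \<psi> v []"
  let ?G = "\<lambda>b u. gapsum W \<psi> (\<lambda>u. L (u @ [b])) u []"
  let ?H = "\<lambda>u. \<Oplus>i\<in>{..<length u}. \<psi> (drop (Suc i) u) \<odot> ?G (u ! i) (take i u)"
  have \<chi>: "?\<chi> [] = 1" using \<phi> \<psi> by (simp add: K.gapsum_Nil)
  have H: "?H u \<in> carrier W" for u using less.prems by (intro finsum_closed) auto
  have "(\<lambda>u. gapsum W \<psi> L u []) = (\<lambda>u. \<psi> u \<odot> L [] \<oplus> ?H u)"
  proof
    show "gapsum W \<psi> L u [] = \<psi> u \<odot> L [] \<oplus> ?H u" for u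
      using gapsum_expand [where L = L and \<phi> = \<psi> and w = u and q = "[]", OF less.prems \<psi>] by (simp only: append_Nil2)
  qed
  then have "gapsum W \<phi> (\<lambda>u. gapsum W \<psi> L u []) w [] =
      gapsum W \<phi> (\<lambda>u. \<psi> u \<odot> L []) w [] \<oplus> gapsum W \<phi> ?H w []"
    using gapsum_add [of "\<lambda>u. \<psi> u \<odot> L []" ?H] H less.prems by simp
  also have "gapsum W \<phi> (\<lambda>u. \<psi> u \<odot> L []) w [] = ?\<chi> w \<odot> L []"
    by (rule gapsum_smult_const) (rule less.prems)
  also have "gapsum W \<phi> ?H w [] =
      (\<Oplus>i\<in>{..<length w}. ?\<chi> (drop (Suc i) w) \<odot> gapsum W \<phi> (?G (w ! i)) (take i w) [])"
    by (rule gapsum_cut) (use less.prems \<phi> in auto)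
  also have "\<dots> = (\<Oplus>i\<in>{..<length w}. ?\<chi> (drop (Suc i) w) \<odot>
      gapsum W ?\<chi> (\<lambda>u. L (u @ [w ! i])) (take i w) [])"
  proof (rule finsum_cong')
    fix i assume "i \<in> {..<length w}"
    then have "gapsum W \<phi> (?G (w ! i)) (take i w) [] = gapsum W ?\<chi> (\<lambda>u. L (u @ [w ! i])) (take i w) []"
      by (intro less.hyps) (use less.prems in auto)
    then show "?\<chi> (drop (Suc i) w) \<odot> gapsum W \<phi> (?G (w ! i)) (take i w) [] =
        ?\<chi> (drop (Suc i) w) \<odot> gapsum W ?\<chi> (\<lambda>u. L (u @ [w ! i])) (take i w) []"
      by simp
  qed (use less.prems in auto)
  also have "?\<chi> w \<odot> L [] \<oplus> \<dots> = gapsum W ?\<chi> L w []"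
    using gapsum_expand [where L = L and \<phi> = ?\<chi> and w = w and q = "[]", OF less.prems \<chi>]
    by (simp only: append_Nil2)
  finally show ?case .
qed

text \<open>Only \<open>S = \<emptyset>\<close> contributes, and its only gap is \<open>w\<close> itself.\<close>

lemma gapsum_delta_word:
  assumes x: "x \<in> carrier W" and \<phi>: "\<phi> [] = 1"
  shows "gapsum W \<phi> (\<lambda>u. if u = [] then x else \<zero>) w [] = \<phi> w \<odot> x"
proof -
  have "gapsum W \<phi> (\<lambda>u. \<zero>) v [] = \<zero>" for v
    unfolding gapsum_def by (simp add: finsum_zero)
  then show ?thesis
    using x \<phi> by (subst gapsum_expand) (auto simp: finsum_zero)
qed

text \<open>Only subsets without gaps contribute; for \<open>q = []\<close> this is the full set of positions.\<close>

lemma gapsum_delta_gap: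
  assumes L: "\<And>u. L u \<in> carrier W"
  shows "gapsum W (\<lambda>v. if v = [] then 1 else 0) L w q = (if q = [] then L w else \<zero>)"
  using L
proof (induction w arbitrary: L q rule: rev_induct)
  case (snoc a w)
  then show ?case by (subst gapsum_snoc) auto
qed (simp add: gapsum_Nil)

end

text \<open>The function \<open>\<phi>\<close> with \<open>gapsum \<bbbK> \<psi> \<phi> w [] = \<epsilon>(w)\<close>, solved for the term in which \<open>S\<close> is the set of
  all positions; the other subsets involve strictly shorter subwords.\<close>

function gap_inverse :: "('b list \<Rightarrow> 'k::field) \<Rightarrow> 'b list \<Rightarrow> 'k" where
  "gap_inverse \<psi> w = (if w = [] then 1 else
     - (\<Sum>S\<in>Pow {..<length w} - {{..<length w}}.
         (\<Prod>J\<in>components ({..<length w} - S). \<psi> (nths w J)) * gap_inverse \<psi> (nths w S)))"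
  by auto
termination
proof (relation "measure (\<lambda>(\<psi>, w). length w)", goal_cases)
  case (2 \<psi> w S)
  then have "S \<subset> {..<length w}" by blast
  moreover from this have "{i. i < length w \<and> i \<in> S} = S" by blast
  ultimately have "card {i. i < length w \<and> i \<in> S} < length w"
    using psubset_card_mono [of "{..<length w}" S] by simp
  then show ?case
    by (simp add: length_nths)
qed simp

declare gap_inverse.simps [simp del]

lemma gap_inverse_Nil [simp]: "gap_inverse \<psi> [] = 1"
  by (subst gap_inverse.simps) simp

lemma gapsum_gap_inverse:
  "gapsum \<bbbK> \<psi> (gap_inverse \<psi>) w [] = (if w = [] then 1 else 0)"
proof (cases "w = []")
  case True
  then show ?thesis by (simp add: gapsum_def finsum_ground)
next
  case False
  let ?t = "\<lambda>S. (\<Prod>J\<in>components ({..<length w} - S). \<psi> (nths w J)) * gap_inverse \<psi> (nths w S)"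
  have "gapsum \<bbbK> \<psi> (gap_inverse \<psi>) w [] = sum ?t (Pow {..<length w})"
    by (simp add: gapsum_def finsum_ground)
  also have "\<dots> = ?t {..<length w} + sum ?t (Pow {..<length w} - {{..<length w}})"
    by (rule sum.remove) auto
  also have "?t {..<length w} = gap_inverse \<psi> w"
    by (simp add: nths_all)
  also have "gap_inverse \<psi> w = - sum ?t (Pow {..<length w} - {{..<length w}})"
    using False by (subst gap_inverse.simps) simp
  finally show ?thesis using False by simp
qed


section \<open>The coproduct\<close>

lemma (in kspace) gapsum_cong:
  assumes "\<And>u. set u \<subseteq> set w \<Longrightarrow> \<phi> u = \<phi>' u" "\<And>u. set u \<subseteq> set w \<Longrightarrow> L u = L' u"
    and "\<And>u. set u \<subseteq> set w \<Longrightarrow> L' u \<in> carrier W"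
  shows "gapsum W \<phi> L w [] = gapsum W \<phi>' L' w []"
  unfolding gapsum_def
  by (rule finsum_cong') (auto simp: assms set_nths_subset intro!: prod.cong arg_cong2 [of _ _ _ _ "smult W"])

text \<open>This turns a linear map \<open>D\<close> into the multilinear map underlying its multiplicative extension to the
  tensor algebra. It applies to the coproduct, with values in the tensor square, and to characters,
  with values in the ground field.\<close>

lemma (in kalg) multilin_foldr:
  assumes D: "lin_on V W D" and V: "kspace V"
  shows "multilin V W (\<lambda>ts. foldr (\<lambda>t z. D t \<otimes> z) ts \<one>)"
proof (rule multilinI)
  have closed: "ts \<in> lists (carrier V) \<Longrightarrow> foldr (\<lambda>t z. D t \<otimes> z) ts \<one> \<in> carrier W" for ts
    by (induction ts) (auto simp: lin_onD(1) [OF D])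
  then show "ts \<in> lists (carrier V) \<Longrightarrow> foldr (\<lambda>t z. D t \<otimes> z) ts \<one> \<in> carrier W" for ts .
  fix u v assume u: "u \<in> lists (carrier V)" and v: "v \<in> lists (carrier V)"
  from u show "lin_on V W (\<lambda>x. foldr (\<lambda>t z. D t \<otimes> z) (u @ [x] @ v) \<one>)"
  proof (induction u)
    case Nil
    then show ?case
      using lin_on_comp [OF D lin_on_mult_right [OF closed [OF v]]] by simp
  next
    case (Cons t u)
    then have "lin_on V W (\<lambda>x. D t \<otimes> foldr (\<lambda>t z. D t \<otimes> z) (u @ [x] @ v) \<one>)"
      using lin_on_comp [OF _ lin_on_mult_left, of V _ "D t"] lin_onD(1) [OF D] by simp
    then show ?case by simp
  qed
qed

text \<open>The map \<open>f \<otimes> g\<close> followed by the identification of \<open>U \<otimes> \<bbbK>\<close> with \<open>U\<close>. Convolution and action are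
  contractions of the coproduct.\<close>

definition contract :: "('k::field, 'u) module \<Rightarrow> ('v \<Rightarrow> 'u) \<Rightarrow> ('w \<Rightarrow> 'k) \<Rightarrow> ('v \<times> 'w \<Rightarrow>\<^sub>0 'k) set \<Rightarrow> 'u" where
  "contract U f g z = tensor_ground U (tensor_map U \<bbbK> f g z)"

lemma contract:
  assumes "kspace V" "kspace W" "kspace U" "lin_on V U f" "lin_on W \<bbbK> g"
  shows contract_lin: "lin_on (tensor V W) U (contract U f g)"
    and contract_pure: "x \<in> carrier V \<Longrightarrow> y \<in> carrier W \<Longrightarrow> contract U f g (pure V W x y) = g y \<odot>\<^bsub>U\<^esub> f x"
proof -
  note map = tensor_map [OF assms(1,2,3) kspace_ground assms(4,5)]
  show "lin_on (tensor V W) U (contract U f g)"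
    using lin_on_comp [OF map(1) tensor_ground_lin [OF assms(3)]] by (simp add: contract_def [abs_def])
  show "x \<in> carrier V \<Longrightarrow> y \<in> carrier W \<Longrightarrow> contract U f g (pure V W x y) = g y \<odot>\<^bsub>U\<^esub> f x"
    using assms by (simp add: contract_def map(2) tensor_ground_pure lin_onD(1))
qed

locale double_tensor = A: kspace A for A :: "('k::field, 'a) module"
begin

abbreviation TP :: "('k, ('k, 'a) tens) module" where
  "TP \<equiv> Tplus A"

abbreviation TTT where
  "TTT \<equiv> tensor (TT A) (TT A)"

sublocale TP: kspace TP
  by (rule kspace_Tplus)

sublocale T: kalg "TT A"
  by (rule TP.kalg_Tbar)

sublocale T2: two_kalgs "TT A" "TT A" ..

sublocale TTT: kalg TTT
  by (rule T2.kalg_tensor)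

sublocale K: kalg "\<bbbK> :: ('k, 'k) module"
  by (rule kalg_ground)

sublocale Tb: kspace "Tbar A"
  by (rule kspace_Tbar)

lemma lin_on_word_Tplus:
  assumes "u \<in> lists (carrier A)" "v \<in> lists (carrier A)"
  shows "lin_on A TP (\<lambda>x. word A (u @ [x] @ v))"
proof (rule lin_onI)
  show "word A (u @ [x] @ v) \<in> carrier TP" if "x \<in> carrier A" for x
    using assms that by (intro word_closed_Tplus) auto
qed (use lin_onD [OF multilinD(2) [OF A.multilin_word assms]] in simp_all)

lemma word_TP_closed: "ts \<in> lists (carrier TP) \<Longrightarrow> word TP ts \<in> carrier (TT A)"
  by (rule word_closed)

lemma incl_word_closed: "w \<in> lists (carrier A) \<Longrightarrow> incl_word A w \<in> carrier (TT A)"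
  by (auto simp: incl_word_def intro!: word_TP_closed word_closed_Tplus)

lemma multilin_incl_word: "multilin A (TT A) (incl_word A)"
proof (rule multilinI)
  fix u v assume uv: "u \<in> lists (carrier A)" "v \<in> lists (carrier A)"
  have "lin_on TP (TT A) (\<lambda>t. word TP [t])"
    using multilinD(2) [OF TP.multilin_word, of "[]" "[]"] by simp
  from lin_on_comp [OF lin_on_word_Tplus [OF uv] this]
  show "lin_on A (TT A) (\<lambda>x. incl_word A (u @ [x] @ v))"
    by (simp add: incl_word_def)
qed (rule incl_word_closed)

lemma incl_lin: "lin_on (Tbar A) (TT A) (incl A)"
  and incl_word: "w \<in> lists (carrier A) \<Longrightarrow> incl A (word A w) = incl_word A w"
  unfolding incl_def using A.lin_ext_Tbar [OF T.kspace_axioms multilin_incl_word] by auto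

text \<open>The product \<open>w\<^sub>1|\<cdots>|w\<^sub>k\<close> in the double tensor algebra.\<close>

definition bar_words :: "'a list list \<Rightarrow> ('k, 'a) dtens" where
  "bar_words Js = word TP (map (word A) Js)"

lemma map_word_closed:
  "Js \<in> lists (lists (carrier A) - {[]}) \<Longrightarrow> map (word A) Js \<in> lists (carrier TP)"
  by (induction Js) (auto intro!: word_closed_Tplus)

lemma bar_closed: "Js \<in> lists (lists (carrier A) - {[]}) \<Longrightarrow> bar_words Js \<in> carrier (TT A)"
  unfolding bar_words_def by (intro word_TP_closed map_word_closed)

lemma coprod_word_bar:
  "coprod_word A w = (\<Oplus>\<^bsub>TTT\<^esub>S\<in>Pow {..<length w}.
     pure (TT A) (TT A) (incl_word A (nths w S)) (bar_words (gap_words w S)))"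
  by (simp add: coprod_word_def bar_words_def gap_words_def comp_def)

lemma bar_gap_words_closed: "w \<in> lists (carrier A) \<Longrightarrow> bar_words (gap_words w S) \<in> carrier (TT A)"
  by (intro bar_closed gap_words_in_lists)

lemma multilin_coprod_word: "multilin A TTT (coprod_word A)"
proof -
  have "multilin A TTT (\<lambda>w. pure (TT A) (TT A) (incl_word A (nths w S)) (bar_words (gap_words w S)))" for S
  proof (rule multilin_split [where P = "\<lambda>s Js. pure (TT A) (TT A) (incl_word A s) (bar_words Js)"])
    fix u v Js assume *: "u \<in> lists (carrier A)" "v \<in> lists (carrier A)"
      "Js \<in> lists (lists (carrier A) - {[]})"
    show "lin_on A TTT (\<lambda>x. pure (TT A) (TT A) (incl_word A (u @ [x] @ v)) (bar_words Js))"
      by (rule lin_on_comp [OF multilinD(2) [OF multilin_incl_word *(1,2)]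
            bilinD(2) [OF T2.bilin_pure bar_closed [OF *(3)]]])
  next
    fix u v s Js Ks assume *: "u \<in> lists (carrier A)" "v \<in> lists (carrier A)" "s \<in> lists (carrier A)"
      "Js \<in> lists (lists (carrier A) - {[]})" "Ks \<in> lists (lists (carrier A) - {[]})"
    have Js: "map (word A) Js \<in> lists (carrier TP)" and Ks: "map (word A) Ks \<in> lists (carrier TP)"
      by (rule map_word_closed [OF *(4)], rule map_word_closed [OF *(5)])
    have "lin_on A (TT A) (\<lambda>x. bar_words (Js @ [u @ [x] @ v] @ Ks))"
      unfolding bar_words_def
      using lin_on_comp [OF lin_on_word_Tplus [OF *(1,2)] multilinD(2) [OF TP.multilin_word Js Ks]]
      by simp
    from lin_on_comp [OF this bilinD(1) [OF T2.bilin_pure incl_word_closed [OF *(3)]]]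
    show "lin_on A TTT (\<lambda>x. pure (TT A) (TT A) (incl_word A s) (bar_words (Js @ [u @ [x] @ v] @ Ks)))" .
  qed (auto intro!: pure_closed incl_word_closed bar_closed A.kspace_axioms TTT.kspace_axioms
      simp del: in_lists_conv_set)
  then have "multilin A TTT (\<lambda>w. \<Oplus>\<^bsub>TTT\<^esub>S\<in>Pow {..<length w}.
      pure (TT A) (TT A) (incl_word A (nths w S)) (bar_words (gap_words w S)))"
    by (rule multilin_finsum [OF A.kspace_axioms TTT.kspace_axioms, where I = "\<lambda>n. Pow {..<n}"]) simp
  then show ?thesis by (simp add: coprod_word_bar [abs_def])
qed

text \<open>The coproduct on single factors, whose multiplicative extension is \<open>coprod A\<close>.\<close>

definition coprod_Tplus :: "('k, 'a) tens \<Rightarrow> (('k, 'a) dtens \<times> ('k, 'a) dtens \<Rightarrow>\<^sub>0 'k) set" where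
  "coprod_Tplus = lin_ext TTT (coprod_word A)"

lemma coprod_Tplus_lin: "lin_on TP TTT coprod_Tplus"
  and coprod_Tplus_word: "w \<in> lists (carrier A) \<Longrightarrow> coprod_Tplus (word A w) = coprod_word A w"
  unfolding coprod_Tplus_def using A.lin_ext_Tbar [OF TTT.kspace_axioms multilin_coprod_word]
  by (auto intro: lin_on_Tplus)

lemma coprod_lin: "lin_on (TT A) TTT (coprod A)"
  and coprod_word_TP: "ts \<in> lists (carrier TP) \<Longrightarrow>
    coprod A (word TP ts) = foldr (\<lambda>t z. coprod_Tplus t \<otimes>\<^bsub>TTT\<^esub> z) ts \<one>\<^bsub>TTT\<^esub>"
  unfolding coprod_def coprod_Tplus_def [symmetric]
  using TP.lin_ext_Tbar [OF TTT.kspace_axioms TTT.multilin_foldr [OF coprod_Tplus_lin TP.kspace_axioms]]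
  by auto

lemma coprod_incl_word:
  assumes w: "w \<in> lists (carrier A)"
  shows "coprod A (incl_word A w) = coprod_word A w"
proof (cases "w = []")
  case True
  have "component_list {} = []"
    using set_component_list [of "{}"] by simp
  then have "coprod_word A [] = pure (TT A) (TT A) \<one>\<^bsub>TT A\<^esub> \<one>\<^bsub>TT A\<^esub>"
    by (simp add: coprod_word_def incl_word_def one_Tbar pure_closed word_TP_closed)
  then show ?thesis
    using True coprod_word_TP [of "[]"] by (simp add: incl_word_def one_Tbar one_tensor)
next
  case False
  have "coprod_word A w \<in> carrier TTT"
    by (rule multilinD(1) [OF multilin_coprod_word w])
  then show ?thesis
    using False w coprod_word_TP [of "[word A w]"]
    by (simp add: incl_word_def word_closed_Tplus coprod_Tplus_word TTT.mult_unit)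
qed


section \<open>The group of characters\<close>

lemma characterD:
  assumes "f \<in> characters A"
  shows character_lin: "lin_on (TT A) \<bbbK> f"
    and character_extensional: "f \<in> extensional (carrier (TT A))"
    and character_mult: "x \<in> carrier (TT A) \<Longrightarrow> y \<in> carrier (TT A) \<Longrightarrow> f (x \<otimes>\<^bsub>TT A\<^esub> y) = f x * f y"
    and character_one: "f \<one>\<^bsub>TT A\<^esub> = 1"
  using assms by (auto simp: characters_def Lin_iff ring_hom_def)

lemma character_incl_Nil: "f \<in> characters A \<Longrightarrow> f (incl_word A []) = 1"
  by (simp add: incl_word_def character_one)

lemma character_word:
  assumes f: "f \<in> characters A" and ts: "ts \<in> lists (carrier TP)"
  shows "f (word TP ts) = (\<Prod>t\<leftarrow>ts. f (word TP [t]))"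
  using ts
proof (induction ts)
  case Nil
  then show ?case using character_one [OF f] by (simp add: one_Tbar)
next
  case (Cons t ts)
  then have "word TP (t # ts) = word TP [t] \<otimes>\<^bsub>TT A\<^esub> word TP ts"
    by (subst TP.word_mult) auto
  then show ?case
    using Cons by (simp add: character_mult [OF f] word_TP_closed)
qed

text \<open>A character is multiplicative for the bar product and the ground field is commutative, so the
  ordered list of components may be replaced by their set.\<close>

lemma character_bar_gap_words:
  assumes f: "f \<in> characters A" and w: "w \<in> lists (carrier A)"
  shows "f (bar_words (gap_words w S)) = (\<Prod>J\<in>components ({..<length w} - S). f (incl_word A (nths w J)))"
proof -
  let ?U = "{..<length w} - S"
  have gaps: "map (word A) (gap_words w S) \<in> lists (carrier TP)"
    by (intro map_word_closed gap_words_in_lists w)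
  have "f (bar_words (gap_words w S)) = (\<Prod>J\<leftarrow>component_list ?U. f (word TP [word A (nths w J)]))"
    unfolding bar_words_def character_word [OF f gaps] by (simp add: gap_words_def comp_def)
  also have "\<dots> = (\<Prod>J\<leftarrow>component_list ?U. f (incl_word A (nths w J)))"
  proof -
    have "nths w J \<noteq> []" if "J \<in> set (component_list ?U)" for J
      using that components_subset [of J ?U] components_nonempty [of J ?U]
      by (intro nths_nonempty) (auto simp: set_component_list)
    then have "map (\<lambda>J. f (word TP [word A (nths w J)])) (component_list ?U) =
        map (\<lambda>J. f (incl_word A (nths w J))) (component_list ?U)"
      by (simp add: incl_word_def)
    then show ?thesis by (rule arg_cong)
  qed
  also have "\<dots> = (\<Prod>J\<in>components ?U. f (incl_word A (nths w J)))"
    by (subst prod.distinct_set_conv_list [symmetric])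
      (simp_all add: distinct_component_list set_component_list)
  finally show ?thesis .
qed

text \<open>Both sides of \<open>F (x \<otimes> y) = F x * F y\<close> are linear in \<open>x\<close> and in \<open>y\<close>, so multiplicativity may be tested on
  words, where the product is concatenation.\<close>

lemma characterI:
  assumes F: "lin_on (TT A) \<bbbK> F"
    and word: "\<And>ts. ts \<in> lists (carrier TP) \<Longrightarrow> F (word TP ts) = (\<Prod>t\<leftarrow>ts. d t)"
  shows "(\<lambda>x\<in>carrier (TT A). F x) \<in> characters A"
proof -
  have mult: "F (x \<otimes>\<^bsub>TT A\<^esub> y) = F x * F y" if x: "x \<in> carrier (TT A)" and y: "y \<in> carrier (TT A)" for x y
  proof -
    have lin_left: "lin_on (TT A) \<bbbK> (\<lambda>x. F (x \<otimes>\<^bsub>TT A\<^esub> y))" if "y \<in> carrier (TT A)" for y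
      using lin_on_comp [OF T.lin_on_mult_right [OF that] F] .
    have lin_left': "lin_on (TT A) \<bbbK> (\<lambda>x. F x * c)" for c
      using lin_on_comp [OF F K.lin_on_mult_right, of c] by simp
    have lin_right: "lin_on (TT A) \<bbbK> (\<lambda>y. F (x \<otimes>\<^bsub>TT A\<^esub> y))"
      using lin_on_comp [OF T.lin_on_mult_left [OF x] F] .
    have lin_right': "lin_on (TT A) \<bbbK> (\<lambda>y. F x * F y)"
      using lin_on_comp [OF F K.lin_on_mult_left, of "F x"] by simp
    show ?thesis
    proof (rule lin_on_Tbar_eqI [OF kspace_ground lin_right lin_right' _ y])
      fix vs assume vs: "vs \<in> lists (carrier TP)"
      show "F (x \<otimes>\<^bsub>TT A\<^esub> word TP vs) = F x * F (word TP vs)"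
      proof (rule lin_on_Tbar_eqI [OF kspace_ground lin_left lin_left' _ x])
        show "F (word TP us \<otimes>\<^bsub>TT A\<^esub> word TP vs) = F (word TP us) * F (word TP vs)"
          if us: "us \<in> lists (carrier TP)" for us
          using us vs by (simp add: TP.word_mult word)
      qed (rule word_TP_closed [OF vs])
    qed
  qed
  have "F \<one>\<^bsub>TT A\<^esub> = 1" using word [of "[]"] by (simp add: one_Tbar)
  then have "(\<lambda>x\<in>carrier (TT A). F x) \<in> ring_hom (TT A) \<bbbK>"
    using mult lin_onD [OF F] by (simp add: ring_hom_def)
  then show ?thesis
    using restrict_Lin [OF T.kspace_axioms F] by (simp add: characters_def)
qed

lemma character_eqI:
  assumes f: "f \<in> characters A" and g: "g \<in> characters A"
    and eq: "\<And>w. w \<in> lists (carrier A) \<Longrightarrow> w \<noteq> [] \<Longrightarrow> f (incl_word A w) = g (incl_word A w)"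
  shows "f = g"
proof (rule extensionalityI [OF character_extensional [OF f] character_extensional [OF g]])
  have single: "lin_on TP (TT A) (\<lambda>t. word TP [t])"
    using multilinD(2) [OF TP.multilin_word, of "[]" "[]"] by simp
  have "f (word TP [t]) = g (word TP [t])" if "t \<in> carrier TP" for t
    by (rule lin_on_Tplus_eqI [OF kspace_ground lin_on_comp [OF single character_lin [OF f]]
          lin_on_comp [OF single character_lin [OF g]] _ that])
      (use eq in \<open>simp add: incl_word_def\<close>)
  then have words: "f (word TP ts) = g (word TP ts)" if "ts \<in> lists (carrier TP)" for ts
    unfolding character_word [OF f that] character_word [OF g that]
    using that by (intro arg_cong [of _ _ prod_list] map_cong) auto
  show "f x = g x" if "x \<in> carrier (TT A)" for x
    by (rule lin_on_Tbar_eqI [OF kspace_ground character_lin [OF f] character_lin [OF g] words that])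
qed

lemma foldr_ground: "foldr (\<lambda>t z. d t \<otimes>\<^bsub>\<bbbK>\<^esub> z) ts \<one>\<^bsub>\<bbbK>\<^esub> = (\<Prod>t\<leftarrow>ts. d t :: 'k)"
  by (induction ts) auto

lemma character_of_lin:
  assumes d: "lin_on TP \<bbbK> d"
  defines "F \<equiv> \<lambda>x\<in>carrier (TT A). lin_ext \<bbbK> (\<lambda>ts. \<Prod>t\<leftarrow>ts. d t) x"
  shows "F \<in> characters A"
    and "ts \<in> lists (carrier TP) \<Longrightarrow> F (word TP ts) = (\<Prod>t\<leftarrow>ts. d t)"
proof -
  have "multilin TP \<bbbK> (\<lambda>ts. \<Prod>t\<leftarrow>ts. d t)"
    using K.multilin_foldr [OF d TP.kspace_axioms] unfolding foldr_ground .
  note * = TP.lin_ext_Tbar [OF kspace_ground this]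
  show "F \<in> characters A" unfolding F_def by (rule characterI [OF *])
  show "F (word TP ts) = (\<Prod>t\<leftarrow>ts. d t)" if "ts \<in> lists (carrier TP)"
    using that by (simp add: F_def word_TP_closed *(2))
qed

lemma character_of_multilin:
  assumes \<phi>: "multilin A \<bbbK> \<phi>"
  obtains F where "F \<in> characters A"
    "\<And>w. w \<in> lists (carrier A) \<Longrightarrow> w \<noteq> [] \<Longrightarrow> F (incl_word A w) = \<phi> w"
proof -
  note * = A.lin_ext_Tbar [OF kspace_ground \<phi>]
  note F = character_of_lin [OF lin_on_Tplus [OF *(1)]]
  show thesis
  proof (rule that [OF F(1)])
    fix w assume w: "w \<in> lists (carrier A)" "w \<noteq> []"
    then have "[word A w] \<in> lists (carrier TP)" using word_closed_Tplus by simp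
    from F(2) [OF this] show "(\<lambda>x\<in>carrier (TT A). lin_ext \<bbbK>
        (\<lambda>ts. prod_list (map (lin_ext \<bbbK> \<phi>) ts)) x) (incl_word A w) = \<phi> w"
      using w by (simp add: incl_word_def *(2) del: restrict_apply)
  qed
qed

text \<open>The counit is the character that extends the zero form, as the empty product is \<open>1\<close>.\<close>

lemma counit: "counit A \<in> characters A"
  and counit_incl_word: "w \<in> lists (carrier A) \<Longrightarrow> counit A (incl_word A w) = (if w = [] then 1 else 0)"
proof -
  have "lin_on TP \<bbbK> (\<lambda>t. 0 :: 'k)" by (rule lin_onI) auto
  note F = character_of_lin [OF this]
  have "(\<Prod>t\<leftarrow>ts. 0 :: 'k) = (if ts = [] then 1 else 0)" for ts :: "('k, 'a) tens list"
    by (cases ts) auto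
  then have eq: "counit A = (\<lambda>x\<in>carrier (TT A). lin_ext \<bbbK> (\<lambda>ts. \<Prod>t\<leftarrow>ts. 0) x)"
    by (simp add: counit_def)
  show "counit A \<in> characters A" unfolding eq by (rule F(1))
  then show "counit A (incl_word A w) = (if w = [] then 1 else 0)" if "w \<in> lists (carrier A)"
    using that F(2) [of "[word A w]"] character_incl_Nil
    by (simp add: incl_word_def eq [symmetric] word_closed_Tplus one_Tbar character_one)
qed

text \<open>Contracting the word coproduct produces a gap sum. The maps \<open>e\<close> and \<open>f\<close> are kept general so that the
  statement covers both convolution (\<open>e = incl_word A\<close>, scalar \<open>f\<close>) and the action (\<open>e = word A\<close>, with \<open>f\<close> an
  endomorphism of \<open>Tbar A\<close>).\<close>

lemma contract_coprod_word:
  assumes U: "kspace U" and V: "kspace V" and g: "g \<in> characters A" and f: "lin_on V U f"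
    and w: "w \<in> lists (carrier A)" and e: "\<And>u. u \<in> lists (carrier A) \<Longrightarrow> e u \<in> carrier V"
    and L: "\<And>u. u \<in> lists (carrier A) \<Longrightarrow> L u = f (e u)"
  shows "contract U f g (\<Oplus>\<^bsub>tensor V (TT A)\<^esub>S\<in>Pow {..<length w}.
      pure V (TT A) (e (nths w S)) (bar_words (gap_words w S))) =
    gapsum U (\<lambda>v. g (incl_word A v)) L w []"
proof -
  interpret U: kspace U by fact
  note c = contract [OF V T.kspace_axioms U f character_lin [OF g]]
  have "contract U f g (\<Oplus>\<^bsub>tensor V (TT A)\<^esub>S\<in>Pow {..<length w}.
      pure V (TT A) (e (nths w S)) (bar_words (gap_words w S))) =
    (\<Oplus>\<^bsub>U\<^esub>S\<in>Pow {..<length w}. contract U f g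
      (pure V (TT A) (e (nths w S)) (bar_words (gap_words w S))))"
    by (intro lin_on_finsum [OF kspace_tensor U c(1)] pure_closed e nths_in_lists
        bar_gap_words_closed w) simp
  also have "\<dots> = gapsum U (\<lambda>v. g (incl_word A v)) L w []"
    unfolding gapsum_def
  proof (rule U.finsum_cong')
    fix S
    note n = nths_in_lists [OF w, of S]
    show "contract U f g (pure V (TT A) (e (nths w S)) (bar_words (gap_words w S))) =
      (\<Prod>J\<in>components ({..<length w + length []} - S). g (incl_word A (nths (w @ []) J))) \<odot>\<^bsub>U\<^esub> L (nths w S)"
      using n w by (simp add: c(2) e L bar_gap_words_closed character_bar_gap_words [OF g]
          del: in_lists_conv_set)
  qed (use nths_in_lists [OF w] lin_onD(1) [OF f] e L in \<open>auto simp del: in_lists_conv_set\<close>)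
  finally show ?thesis .
qed

text \<open>The tensor product of two characters is multiplicative: this is clear on pure tensors, and both
  sides are bilinear.\<close>

lemma contract_mult:
  assumes f: "f \<in> characters A" and g: "g \<in> characters A"
    and z: "z \<in> carrier TTT" and z': "z' \<in> carrier TTT"
  shows "contract \<bbbK> f g (z \<otimes>\<^bsub>TTT\<^esub> z') = contract \<bbbK> f g z * contract \<bbbK> f g z'"
proof -
  let ?h = "contract \<bbbK> f g"
  note c = contract [OF T.kspace_axioms T.kspace_axioms kspace_ground character_lin [OF f] character_lin [OF g]]
  have lin_left': "lin_on TTT \<bbbK> (\<lambda>z. ?h z * a)" for a
    using lin_on_comp [OF c(1) K.lin_on_mult_right, of a] by simp
  have lin_right': "lin_on TTT \<bbbK> (\<lambda>z'. a * ?h z')" for a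
    using lin_on_comp [OF c(1) K.lin_on_mult_left, of a] by simp
  show ?thesis
  proof (rule lin_on_tensor_eqI [OF kspace_ground lin_on_comp [OF TTT.lin_on_mult_left [OF z] c(1)] lin_right' _ z'])
    fix x' y' assume xy': "x' \<in> carrier (TT A)" "y' \<in> carrier (TT A)"
    note p' = pure_closed [OF xy']
    show "?h (z \<otimes>\<^bsub>TTT\<^esub> pure (TT A) (TT A) x' y') = ?h z * ?h (pure (TT A) (TT A) x' y')"
    proof (rule lin_on_tensor_eqI [OF kspace_ground lin_on_comp [OF TTT.lin_on_mult_right [OF p'] c(1)] lin_left' _ z])
      fix x y assume xy: "x \<in> carrier (TT A)" "y \<in> carrier (TT A)"
      show "?h (pure (TT A) (TT A) x y \<otimes>\<^bsub>TTT\<^esub> pure (TT A) (TT A) x' y') =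
          ?h (pure (TT A) (TT A) x y) * ?h (pure (TT A) (TT A) x' y')"
        using xy xy' by (simp add: T2.pure_mult c(2) character_mult [OF f] character_mult [OF g])
    qed
  qed
qed

lemma convolution_contract: "convolution A f g = (\<lambda>x\<in>carrier (TT A). contract \<bbbK> f g (coprod A x))"
  by (simp add: convolution_def contract_def)

lemma convolution:
  assumes f: "f \<in> characters A" and g: "g \<in> characters A"
  shows convolution_character: "convolution A f g \<in> characters A"
    and convolution_incl_word: "w \<in> lists (carrier A) \<Longrightarrow> convolution A f g (incl_word A w) =
      gapsum \<bbbK> (\<lambda>v. g (incl_word A v)) (\<lambda>v. f (incl_word A v)) w []"
proof -
  let ?h = "contract \<bbbK> f g"
  note c = contract [OF T.kspace_axioms T.kspace_axioms kspace_ground character_lin [OF f] character_lin [OF g]]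
  have "?h (foldr (\<lambda>t z. coprod_Tplus t \<otimes>\<^bsub>TTT\<^esub> z) ts \<one>\<^bsub>TTT\<^esub>) = (\<Prod>t\<leftarrow>ts. ?h (coprod_Tplus t))"
    if "ts \<in> lists (carrier TP)" for ts
    using that
  proof (induction ts)
    case Nil
    then show ?case
      using c(2) [of "\<one>\<^bsub>TT A\<^esub>" "\<one>\<^bsub>TT A\<^esub>"] by (simp add: one_tensor character_one f g)
  next
    case (Cons t ts)
    then show ?case
      using lin_onD(1) [OF coprod_Tplus_lin] multilinD(1) [OF TTT.multilin_foldr [OF coprod_Tplus_lin TP.kspace_axioms]]
      by (simp add: contract_mult [OF f g])
  qed
  then show "convolution A f g \<in> characters A"
    unfolding convolution_contract
    by (intro characterI lin_on_comp [OF coprod_lin c(1)]) (simp add: coprod_word_TP)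
  show "convolution A f g (incl_word A w) =
      gapsum \<bbbK> (\<lambda>v. g (incl_word A v)) (\<lambda>v. f (incl_word A v)) w []" if w: "w \<in> lists (carrier A)"
    using contract_coprod_word [OF kspace_ground T.kspace_axioms g character_lin [OF f] w incl_word_closed refl]
    by (simp add: convolution_contract incl_word_closed [OF w] coprod_incl_word [OF w] coprod_word_bar)
qed

text \<open>By induction on the length: the recursion for \<open>gap_inverse\<close> at a word is a sum over the proper subsets
  \<open>S\<close>, and each term is multilinear by \<open>multilin_split\<close>, whose linearity condition on the subword of \<open>S\<close>
  is the induction hypothesis.\<close>

lemma multilin_gap_inverse:
  assumes g: "g \<in> characters A"
  shows "multilin A \<bbbK> (gap_inverse (\<lambda>v. g (incl_word A v)))"
proof -
  let ?\<psi> = "\<lambda>v. g (incl_word A v)"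
  let ?\<phi> = "gap_inverse ?\<psi>"
  have lin: "lin_on A \<bbbK> (\<lambda>x. ?\<phi> (u @ [x] @ v))"
    if "u \<in> lists (carrier A)" "v \<in> lists (carrier A)" for u v
    using that
  proof (induction "length (u @ v)" arbitrary: u v rule: less_induct)
    case less
    define n where "n = Suc (length (u @ v))"
    \<comment> \<open>The cut-off at length \<open>n\<close> restricts the linearity condition on \<open>P\<close> to words to which the induction
  hypothesis applies. It does not change the terms of the recursion, since a proper subset selects a
  word shorter than \<open>n\<close>.\<close>
    define P where "P s Js = (if length s < n then g (bar_words Js) * ?\<phi> s else 0)" for s Js
    have "multilin A \<bbbK> (\<lambda>w. P (nths w S) (gap_words w S))" for S
    proof (rule multilin_split [OF A.kspace_axioms kspace_ground])
      fix u v Js assume *: "u \<in> lists (carrier A)" "v \<in> lists (carrier A)"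
        "Js \<in> lists (lists (carrier A) - {[]})"
      show "lin_on A \<bbbK> (\<lambda>x. P (u @ [x] @ v) Js)"
      proof (cases "Suc (length (u @ v)) < n")
        case True
        then have "lin_on A \<bbbK> (\<lambda>x. ?\<phi> (u @ [x] @ v))"
          using less.hyps [OF _ *(1,2)] by (simp add: n_def)
        from lin_on_comp [OF this K.lin_on_mult_left, of "g (bar_words Js)"] True
        show ?thesis by (simp add: P_def)
      next
        case False
        then show ?thesis by (simp add: P_def lin_on_def)
      qed
    next
      fix u v s Js Ks assume *: "u \<in> lists (carrier A)" "v \<in> lists (carrier A)" "s \<in> lists (carrier A)"
        "Js \<in> lists (lists (carrier A) - {[]})" "Ks \<in> lists (lists (carrier A) - {[]})"
      have "map (word A) Js \<in> lists (carrier TP)" "map (word A) Ks \<in> lists (carrier TP)"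
        by (rule map_word_closed [OF *(4)], rule map_word_closed [OF *(5)])
      note bar_words = lin_on_comp [OF lin_on_word_Tplus [OF *(1,2)] multilinD(2) [OF TP.multilin_word this]]
      from lin_on_comp [OF lin_on_comp [OF bar_words character_lin [OF g]] K.lin_on_mult_right, of "?\<phi> s"]
      show "lin_on A \<bbbK> (\<lambda>x. P s (Js @ [u @ [x] @ v] @ Ks))"
        by (cases "length s < n") (simp_all add: P_def bar_words_def lin_on_def)
    qed simp
    then have "multilin A \<bbbK> (\<lambda>w. \<Oplus>\<^bsub>\<bbbK>\<^esub>S\<in>Pow {..<length w} - {{..<length w}}. P (nths w S) (gap_words w S))"
      by (rule multilin_finsum [OF A.kspace_axioms kspace_ground,
            where I = "\<lambda>n. Pow {..<n} - {{..<n}}"]) simp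
    from multilinD(2) [OF this less.prems]
    have "lin_on A \<bbbK> (\<lambda>x. \<Oplus>\<^bsub>\<bbbK>\<^esub>S\<in>Pow {..<n} - {{..<n}}. P (nths (u @ [x] @ v) S) (gap_words (u @ [x] @ v) S))"
      by (simp add: n_def)
    from lin_on_comp [OF this K.lin_on_mult_left, of "-1"]
    have *: "lin_on A \<bbbK> (\<lambda>x. - (\<Sum>S\<in>Pow {..<n} - {{..<n}}. P (nths (u @ [x] @ v) S) (gap_words (u @ [x] @ v) S)))"
      by (simp add: finsum_ground)
    show ?case
    proof (rule lin_on_cong [OF _ A.kspace_axioms *])
      fix x assume x: "x \<in> carrier A"
      let ?w = "u @ [x] @ v"
      have w: "?w \<in> lists (carrier A)" using x less.prems by auto
      have n: "length ?w = n" by (simp add: n_def)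
      have "P (nths ?w S) (gap_words ?w S) =
          (\<Prod>J\<in>components ({..<n} - S). ?\<psi> (nths ?w J)) * ?\<phi> (nths ?w S)"
        if "S \<in> Pow {..<n} - {{..<n}}" for S
      proof -
        have S: "S \<subset> {..<n}" using that by blast
        then have "{i. i < n \<and> i \<in> S} = S" by blast
        then have "length (nths ?w S) < n"
          unfolding length_nths n using psubset_card_mono [OF _ S] by simp
        then show ?thesis
          using character_bar_gap_words [OF g w, of S] unfolding n by (simp add: P_def)
      qed
      then have "(\<Sum>S\<in>Pow {..<n} - {{..<n}}. P (nths ?w S) (gap_words ?w S)) =
          (\<Sum>S\<in>Pow {..<n} - {{..<n}}. (\<Prod>J\<in>components ({..<n} - S). ?\<psi> (nths ?w J)) * ?\<phi> (nths ?w S))"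
        by (rule sum.cong [OF refl])
      then show "- (\<Sum>S\<in>Pow {..<n} - {{..<n}}. P (nths ?w S) (gap_words ?w S)) = ?\<phi> ?w"
        by (subst gap_inverse.simps) (simp only: n, simp)
    qed
  qed
  show ?thesis by (rule multilinI) (use lin in auto)
qed

lemma group_character_group: "group (character_group A)"
proof (rule groupI)
  show "f \<otimes>\<^bsub>character_group A\<^esub> g \<in> carrier (character_group A)"
    if "f \<in> carrier (character_group A)" "g \<in> carrier (character_group A)" for f g
    using that by (simp add: character_group_def convolution_character)
  show "\<one>\<^bsub>character_group A\<^esub> \<in> carrier (character_group A)"
    by (simp add: character_group_def counit)
  show "f \<otimes>\<^bsub>character_group A\<^esub> g \<otimes>\<^bsub>character_group A\<^esub> h =
      f \<otimes>\<^bsub>character_group A\<^esub> (g \<otimes>\<^bsub>character_group A\<^esub> h)"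
    if "f \<in> carrier (character_group A)" "g \<in> carrier (character_group A)"
      "h \<in> carrier (character_group A)" for f g h
  proof -
    from that have f: "f \<in> characters A" and g: "g \<in> characters A" and h: "h \<in> characters A"
      by (simp_all add: character_group_def)
    note fg = convolution [OF f g] and gh = convolution [OF g h]
    have "convolution A (convolution A f g) h = convolution A f (convolution A g h)"
    proof (rule character_eqI)
      fix w assume w: "w \<in> lists (carrier A)"
      have sub: "u \<in> lists (carrier A)" if "set u \<subseteq> set w" for u using that w by auto
      have "convolution A (convolution A f g) h (incl_word A w) =
          gapsum \<bbbK> (\<lambda>v. h (incl_word A v)) (\<lambda>v. convolution A f g (incl_word A v)) w []"
        by (rule convolution_incl_word [OF fg(1) h w])
      also have "\<dots> = gapsum \<bbbK> (\<lambda>v. h (incl_word A v)) (\<lambda>u. gapsum \<bbbK> (\<lambda>v. g (incl_word A v))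
          (\<lambda>v. f (incl_word A v)) u []) w []"
        by (rule K.gapsum_cong) (simp_all add: fg(2) sub del: in_lists_conv_set)
      also have "\<dots> = gapsum \<bbbK> (\<lambda>u. gapsum \<bbbK> (\<lambda>v. h (incl_word A v)) (\<lambda>v. g (incl_word A v)) u [])
          (\<lambda>v. f (incl_word A v)) w []"
        by (rule K.gapsum_gapsum) (simp_all add: character_incl_Nil g h)
      also have "\<dots> = gapsum \<bbbK> (\<lambda>v. convolution A g h (incl_word A v)) (\<lambda>v. f (incl_word A v)) w []"
        by (rule K.gapsum_cong) (simp_all add: gh(2) sub del: in_lists_conv_set)
      also have "\<dots> = convolution A f (convolution A g h) (incl_word A w)"
        by (rule convolution_incl_word [OF f gh(1) w, symmetric])
      finally show "convolution A (convolution A f g) h (incl_word A w) =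
          convolution A f (convolution A g h) (incl_word A w)" .
    qed (use f g h in \<open>auto intro!: convolution_character\<close>)
    then show ?thesis by (simp add: character_group_def)
  qed
  show "\<one>\<^bsub>character_group A\<^esub> \<otimes>\<^bsub>character_group A\<^esub> f = f" if "f \<in> carrier (character_group A)" for f
  proof -
    from that have f: "f \<in> characters A" by (simp add: character_group_def)
    have "convolution A (counit A) f = f"
    proof (rule character_eqI)
      fix w assume w: "w \<in> lists (carrier A)"
      have sub: "u \<in> lists (carrier A)" if "set u \<subseteq> set w" for u using that w by auto
      have "convolution A (counit A) f (incl_word A w) =
          gapsum \<bbbK> (\<lambda>v. f (incl_word A v)) (\<lambda>v. counit A (incl_word A v)) w []"
        by (rule convolution_incl_word [OF counit f w])
      also have "\<dots> = gapsum \<bbbK> (\<lambda>v. f (incl_word A v)) (\<lambda>v. if v = [] then 1 else \<zero>\<^bsub>\<bbbK>\<^esub>) w []"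
        by (rule K.gapsum_cong) (simp_all add: counit_incl_word sub del: in_lists_conv_set)
      also have "\<dots> = f (incl_word A w)"
        by (subst K.gapsum_delta_word) (simp_all add: character_incl_Nil f)
      finally show "convolution A (counit A) f (incl_word A w) = f (incl_word A w)" .
    qed (use f counit in \<open>auto intro!: convolution_character\<close>)
    then show ?thesis by (simp add: character_group_def)
  qed
  show "\<exists>g\<in>carrier (character_group A). g \<otimes>\<^bsub>character_group A\<^esub> f = \<one>\<^bsub>character_group A\<^esub>"
    if "f \<in> carrier (character_group A)" for f
  proof -
    from that have f: "f \<in> characters A" by (simp add: character_group_def)
    let ?\<phi> = "gap_inverse (\<lambda>v. f (incl_word A v))"
    obtain g where g: "g \<in> characters A"
      "\<And>w. w \<in> lists (carrier A) \<Longrightarrow> w \<noteq> [] \<Longrightarrow> g (incl_word A w) = ?\<phi> w"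
      using character_of_multilin [OF multilin_gap_inverse [OF f]] by metis
    have g': "g (incl_word A w) = ?\<phi> w" if "w \<in> lists (carrier A)" for w
      using that g character_incl_Nil [OF g(1)] by (cases "w = []") auto
    have "convolution A g f = counit A"
    proof (rule character_eqI)
      fix w assume w: "w \<in> lists (carrier A)"
      have sub: "u \<in> lists (carrier A)" if "set u \<subseteq> set w" for u using that w by auto
      have "convolution A g f (incl_word A w) =
          gapsum \<bbbK> (\<lambda>v. f (incl_word A v)) (\<lambda>v. g (incl_word A v)) w []"
        by (rule convolution_incl_word [OF g(1) f w])
      also have "\<dots> = gapsum \<bbbK> (\<lambda>v. f (incl_word A v)) ?\<phi> w []"
        by (rule K.gapsum_cong) (simp_all add: g' sub del: in_lists_conv_set)
      also have "\<dots> = counit A (incl_word A w)"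
        by (simp add: gapsum_gap_inverse counit_incl_word w del: in_lists_conv_set)
      finally show "convolution A g f (incl_word A w) = counit A (incl_word A w)" .
    qed (use f g counit in \<open>auto intro!: convolution_character\<close>)
    then show ?thesis using g(1) by (auto simp: character_group_def)
  qed
qed


section \<open>The action on endomorphisms\<close>

text \<open>The left inverse keeps the bar products with at most one factor and annihilates the others.\<close>

lemma incl_left_inverse:
  obtains p where "lin_on (TT A) (Tbar A) p" "\<And>x. x \<in> carrier (Tbar A) \<Longrightarrow> p (incl A x) = x"
proof -
  define F where "F ts = (case ts of [] \<Rightarrow> \<one>\<^bsub>Tbar A\<^esub> | [t] \<Rightarrow> t | _ \<Rightarrow> \<zero>\<^bsub>Tbar A\<^esub>)" for ts :: "('k, 'a) tens list"
  have F: "multilin TP (Tbar A) F"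
  proof (rule multilinI)
    fix u v assume "u \<in> lists (carrier TP)" "v \<in> lists (carrier TP)"
    show "lin_on TP (Tbar A) (\<lambda>x. F (u @ [x] @ v))"
    proof (cases "u = [] \<and> v = []")
      case True
      then show ?thesis using Tplus_subset [of A] by (auto simp: F_def lin_on_def)
    next
      case False
      then have "F (u @ [x] @ v) = \<zero>\<^bsub>Tbar A\<^esub>" for x
        by (cases u; cases v) (auto simp: F_def split: list.split)
      then show ?thesis by (simp add: lin_on_def)
    qed
  next
    show "ts \<in> lists (carrier TP) \<Longrightarrow> F ts \<in> carrier (Tbar A)" for ts
      using Tplus_subset [of A] by (auto simp: F_def one_Tbar word_closed split: list.split)
  qed
  note p = TP.lin_ext_Tbar [OF Tb.kspace_axioms F]
  have "lin_ext (Tbar A) F (incl A x) = x" if x: "x \<in> carrier (Tbar A)" for x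
  proof (rule lin_on_Tbar_eqI [OF Tb.kspace_axioms lin_on_comp [OF incl_lin p(1)] _ _ x])
    show "lin_on (Tbar A) (Tbar A) (\<lambda>x. x)" by (simp add: lin_on_def)
    fix w assume w: "w \<in> lists (carrier A)"
    show "lin_ext (Tbar A) F (incl A (word A w)) = word A w"
      using w p(2) [of "[]"] p(2) [of "[word A w]"]
      by (simp add: incl_word incl_word_def one_Tbar F_def word_closed_Tplus del: in_lists_conv_set)
  qed
  with p(1) show thesis by (rule that)
qed

text \<open>If \<open>p\<close> is a left inverse of \<open>incl A\<close>, then \<open>p \<otimes> id\<close> is a left inverse of \<open>incl \<otimes> id\<close>.\<close>

lemma incl_tensor_id:
  shows incl_tensor_id_lin: "lin_on (tensor (Tbar A) (TT A)) TTT (incl_tensor_id A)"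
    and incl_tensor_id_pure: "x \<in> carrier (Tbar A) \<Longrightarrow> y \<in> carrier (TT A) \<Longrightarrow>
      incl_tensor_id A (pure (Tbar A) (TT A) x y) = pure (TT A) (TT A) (incl A x) y"
    and inj_incl_tensor_id: "inj_on (incl_tensor_id A) (carrier (tensor (Tbar A) (TT A)))"
proof -
  have id: "lin_on (TT A) (TT A) id" by (simp add: lin_on_def)
  note m = tensor_map [OF Tb.kspace_axioms T.kspace_axioms T.kspace_axioms T.kspace_axioms incl_lin id]
  show lin: "lin_on (tensor (Tbar A) (TT A)) TTT (incl_tensor_id A)" by (rule m(1))
  show pure: "incl_tensor_id A (pure (Tbar A) (TT A) x y) = pure (TT A) (TT A) (incl A x) y"
    if "x \<in> carrier (Tbar A)" "y \<in> carrier (TT A)" for x y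
    using m(2) [OF that] by simp
  obtain p where p: "lin_on (TT A) (Tbar A) p" "\<And>x. x \<in> carrier (Tbar A) \<Longrightarrow> p (incl A x) = x"
    by (rule incl_left_inverse) blast
  note q = tensor_map [OF T.kspace_axioms T.kspace_axioms Tb.kspace_axioms T.kspace_axioms p(1) id]
  have "tensor_map (Tbar A) (TT A) p id (incl_tensor_id A z) = z"
    if z: "z \<in> carrier (tensor (Tbar A) (TT A))" for z
  proof (rule lin_on_tensor_eqI [OF kspace_tensor lin_on_comp [OF lin q(1)] _ _ z])
    show "lin_on (tensor (Tbar A) (TT A)) (tensor (Tbar A) (TT A)) (\<lambda>z. z)" by (simp add: lin_on_def)
    show "tensor_map (Tbar A) (TT A) p id (incl_tensor_id A (pure (Tbar A) (TT A) x y)) =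
        pure (Tbar A) (TT A) x y" if "x \<in> carrier (Tbar A)" "y \<in> carrier (TT A)" for x y
      using that lin_onD(1) [OF incl_lin] by (simp add: pure q(2) p(2))
  qed
  then show "inj_on (incl_tensor_id A) (carrier (tensor (Tbar A) (TT A)))"
    by (rule inj_on_inverseI)
qed

text \<open>The word coproduct with its left factors read in \<open>Tbar A\<close> instead of \<open>TT A\<close>.\<close>

definition coprod_restr_word :: "'a list \<Rightarrow> (('k, 'a) tens \<times> ('k, 'a) dtens \<Rightarrow>\<^sub>0 'k) set" where
  "coprod_restr_word w = (\<Oplus>\<^bsub>tensor (Tbar A) (TT A)\<^esub>S\<in>Pow {..<length w}.
     pure (Tbar A) (TT A) (word A (nths w S)) (bar_words (gap_words w S)))"

lemma coprod_restr_word: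
  assumes w: "w \<in> lists (carrier A)"
  shows coprod_restr_word_closed: "coprod_restr_word w \<in> carrier (tensor (Tbar A) (TT A))"
    and incl_coprod_restr_word: "incl_tensor_id A (coprod_restr_word w) = coprod A (incl A (word A w))"
proof -
  interpret X: kspace "tensor (Tbar A) (TT A)" by (rule kspace_tensor)
  have closed: "pure (Tbar A) (TT A) (word A (nths w S)) (bar_words (gap_words w S))
      \<in> carrier (tensor (Tbar A) (TT A))" for S
    by (intro pure_closed word_closed nths_in_lists bar_gap_words_closed w)
  show "coprod_restr_word w \<in> carrier (tensor (Tbar A) (TT A))"
    unfolding coprod_restr_word_def using closed by (intro X.finsum_closed) auto
  have "incl_tensor_id A (coprod_restr_word w) = (\<Oplus>\<^bsub>TTT\<^esub>S\<in>Pow {..<length w}.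
      incl_tensor_id A (pure (Tbar A) (TT A) (word A (nths w S)) (bar_words (gap_words w S))))"
    unfolding coprod_restr_word_def
    by (rule lin_on_finsum [OF kspace_tensor TTT.kspace_axioms incl_tensor_id_lin]) (use closed in auto)
  also have "\<dots> = coprod_word A w"
    unfolding coprod_word_bar
    by (rule TTT.finsum_cong') (use nths_in_lists [OF w] w in
        \<open>auto simp: incl_tensor_id_pure word_closed bar_gap_words_closed incl_word simp del: in_lists_conv_set
          intro!: pure_closed incl_word_closed bar_gap_words_closed\<close>)
  finally show "incl_tensor_id A (coprod_restr_word w) = coprod A (incl A (word A w))"
    by (simp add: incl_word [OF w] coprod_incl_word [OF w])
qed

lemma coprod_incl_in_image:
  assumes "x \<in> carrier (Tbar A)"
  shows "coprod A (incl A x) \<in> incl_tensor_id A ` carrier (tensor (Tbar A) (TT A))"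
proof -
  interpret X: kspace "tensor (Tbar A) (TT A)" by (rule kspace_tensor)
  note c = lin_on_comp [OF incl_lin coprod_lin]
  from assms show ?thesis
    unfolding Tbar_def [of A]
  proof (induction rule: presented_induct)
    case zero
    have "coprod A (incl A \<zero>\<^bsub>Tbar A\<^esub>) = incl_tensor_id A \<zero>\<^bsub>tensor (Tbar A) (TT A)\<^esub>"
      using lin_on_zero [OF Tb.kspace_axioms TTT.kspace_axioms c]
        lin_on_zero [OF kspace_tensor TTT.kspace_axioms incl_tensor_id_lin] by simp
    then show ?case unfolding Tbar_def [symmetric] by (rule image_eqI [OF _ X.zero_closed])
  next
    case (step w a y)
    note step = step [folded Tbar_def word_gen]
    from step have w: "w \<in> lists (carrier A)" by simp
    from step(3) obtain z where z: "z \<in> carrier (tensor (Tbar A) (TT A))"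
      "coprod A (incl A y) = incl_tensor_id A z" by blast
    let ?z = "a \<odot>\<^bsub>tensor (Tbar A) (TT A)\<^esub> coprod_restr_word w \<oplus>\<^bsub>tensor (Tbar A) (TT A)\<^esub> z"
    have "coprod A (incl A (a \<odot>\<^bsub>Tbar A\<^esub> word A w \<oplus>\<^bsub>Tbar A\<^esub> y)) = incl_tensor_id A ?z"
      using step(2) z coprod_restr_word [OF w]
      by (simp add: lin_onD [OF c] lin_onD [OF incl_tensor_id_lin] word_closed w del: in_lists_conv_set)
    moreover have "?z \<in> carrier (tensor (Tbar A) (TT A))"
      using z(1) coprod_restr_word(1) [OF w] by simp
    ultimately show ?case unfolding Tbar_def [symmetric] word_gen [symmetric] by blast
  qed
qed

lemma coprod_restr_eqI:
  assumes "z \<in> carrier (tensor (Tbar A) (TT A))" "incl_tensor_id A z = coprod A (incl A x)"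
  shows "coprod_restr A x = z"
  unfolding coprod_restr_def
  by (rule the_equality) (use assms inj_onD [OF inj_incl_tensor_id] in auto)

lemma coprod_restr:
  assumes "x \<in> carrier (Tbar A)"
  shows "coprod_restr A x \<in> carrier (tensor (Tbar A) (TT A))"
    and "incl_tensor_id A (coprod_restr A x) = coprod A (incl A x)"
proof -
  from coprod_incl_in_image [OF assms] obtain z where z: "z \<in> carrier (tensor (Tbar A) (TT A))"
    "coprod A (incl A x) = incl_tensor_id A z" by blast
  have "coprod_restr A x = z" by (rule coprod_restr_eqI [OF z(1) z(2) [symmetric]])
  then show "coprod_restr A x \<in> carrier (tensor (Tbar A) (TT A))"
    "incl_tensor_id A (coprod_restr A x) = coprod A (incl A x)"
    using z by (simp_all only:)
qed

lemma coprod_restr_lin: "lin_on (Tbar A) (tensor (Tbar A) (TT A)) (coprod_restr A)"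
proof -
  interpret X: kspace "tensor (Tbar A) (TT A)" by (rule kspace_tensor)
  note c = lin_on_comp [OF incl_lin coprod_lin]
  show ?thesis
  proof (rule lin_onI)
    show "coprod_restr A (x \<oplus>\<^bsub>Tbar A\<^esub> y) = coprod_restr A x \<oplus>\<^bsub>tensor (Tbar A) (TT A)\<^esub> coprod_restr A y"
      if "x \<in> carrier (Tbar A)" "y \<in> carrier (Tbar A)" for x y
      using that by (intro coprod_restr_eqI)
        (simp_all add: coprod_restr lin_onD [OF c] lin_onD [OF incl_tensor_id_lin])
    show "coprod_restr A (a \<odot>\<^bsub>Tbar A\<^esub> x) = a \<odot>\<^bsub>tensor (Tbar A) (TT A)\<^esub> coprod_restr A x"
      if "x \<in> carrier (Tbar A)" for a x
      using that by (intro coprod_restr_eqI)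
        (simp_all add: coprod_restr lin_onD [OF c] lin_onD [OF incl_tensor_id_lin])
  qed (rule coprod_restr)
qed

lemma char_act_contract:
  "char_act A L \<Psi> = (\<lambda>x\<in>carrier (Tbar A). contract (Tbar A) L \<Psi> (coprod_restr A x))"
  by (simp add: char_act_def contract_def)

text \<open>The restriction of \<open>L\<close> to words, extended by zero to lists with letters outside \<open>A\<close>: gap sums are
  taken of functions that are defined on all lists and take values in the carrier.\<close>

definition on_words :: "(('k, 'a) tens \<Rightarrow> ('k, 'a) tens) \<Rightarrow> 'a list \<Rightarrow> ('k, 'a) tens" where
  "on_words L w = (if w \<in> lists (carrier A) then L (word A w) else \<zero>\<^bsub>Tbar A\<^esub>)"

lemma on_words_closed: "L \<in> Lin (Tbar A) (Tbar A) \<Longrightarrow> on_words L w \<in> carrier (Tbar A)"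
  using lin_onD(1) [of "Tbar A" "Tbar A" L "word A w"]
  by (simp add: on_words_def Lin_iff word_closed del: in_lists_conv_set)

lemma char_act:
  assumes L: "L \<in> Lin (Tbar A) (Tbar A)" and \<Psi>: "\<Psi> \<in> characters A"
  shows char_act_Lin: "char_act A L \<Psi> \<in> Lin (Tbar A) (Tbar A)"
    and char_act_word: "w \<in> lists (carrier A) \<Longrightarrow> char_act A L \<Psi> (word A w) =
      gapsum (Tbar A) (\<lambda>v. \<Psi> (incl_word A v)) (on_words L) w []"
proof -
  have L': "lin_on (Tbar A) (Tbar A) L" using L by (simp add: Lin_iff)
  note c = contract [OF Tb.kspace_axioms T.kspace_axioms Tb.kspace_axioms L' character_lin [OF \<Psi>]]
  show "char_act A L \<Psi> \<in> Lin (Tbar A) (Tbar A)"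
    unfolding char_act_contract
    by (rule restrict_Lin [OF Tb.kspace_axioms lin_on_comp [OF coprod_restr_lin c(1)]])
  assume w: "w \<in> lists (carrier A)"
  have "char_act A L \<Psi> (word A w) = contract (Tbar A) L \<Psi> (coprod_restr_word w)"
    using w coprod_restr_word [OF w] by (simp add: char_act_contract word_closed coprod_restr_eqI del: in_lists_conv_set)
  also have "\<dots> = gapsum (Tbar A) (\<lambda>v. \<Psi> (incl_word A v)) (on_words L) w []"
    unfolding coprod_restr_word_def
    by (rule contract_coprod_word [OF Tb.kspace_axioms Tb.kspace_axioms \<Psi> L' w])
      (simp_all add: word_closed on_words_def del: in_lists_conv_set)
  finally show "char_act A L \<Psi> (word A w) =
      gapsum (Tbar A) (\<lambda>v. \<Psi> (incl_word A v)) (on_words L) w []" .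
qed

lemma Lin_Tbar_eqI:
  assumes "L \<in> Lin (Tbar A) (Tbar A)" "L' \<in> Lin (Tbar A) (Tbar A)"
    and "\<And>w. w \<in> lists (carrier A) \<Longrightarrow> L (word A w) = L' (word A w)"
  shows "L = L'"
  using assms lin_on_Tbar_eqI [OF Tb.kspace_axioms, of A L L']
  by (intro extensionalityI [of L "carrier (Tbar A)" L']) (auto simp: Lin_iff)

lemma char_act_counit:
  assumes L: "L \<in> Lin (Tbar A) (Tbar A)"
  shows "char_act A L (counit A) = L"
proof (rule Lin_Tbar_eqI [OF char_act_Lin [OF L counit] L])
  fix w assume w: "w \<in> lists (carrier A)"
  have sub: "u \<in> lists (carrier A)" if "set u \<subseteq> set w" for u using that w by auto
  have "char_act A L (counit A) (word A w) =
      gapsum (Tbar A) (\<lambda>v. counit A (incl_word A v)) (on_words L) w []"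
    by (rule char_act_word [OF L counit w])
  also have "\<dots> = gapsum (Tbar A) (\<lambda>v. if v = [] then 1 else 0) (on_words L) w []"
    by (rule Tb.gapsum_cong)
      (simp_all add: counit_incl_word sub on_words_closed [OF L] del: in_lists_conv_set)
  also have "\<dots> = L (word A w)"
    unfolding Tb.gapsum_delta_gap [where L = "on_words L", OF on_words_closed [OF L]]
    using w by (simp add: on_words_def)
  finally show "char_act A L (counit A) (word A w) = L (word A w)" .
qed

lemma char_act_convolution:
  assumes L: "L \<in> Lin (Tbar A) (Tbar A)" and f: "f \<in> characters A" and g: "g \<in> characters A"
  shows "char_act A (char_act A L f) g = char_act A L (convolution A f g)"
proof (rule Lin_Tbar_eqI)
  fix w assume w: "w \<in> lists (carrier A)"
  have sub: "u \<in> lists (carrier A)" if "set u \<subseteq> set w" for u using that w by auto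
  note closed = on_words_closed [OF L]
  have "char_act A (char_act A L f) g (word A w) =
      gapsum (Tbar A) (\<lambda>v. g (incl_word A v)) (on_words (char_act A L f)) w []"
    by (rule char_act_word [OF char_act_Lin [OF L f] g w])
  also have "\<dots> = gapsum (Tbar A) (\<lambda>v. g (incl_word A v))
      (\<lambda>u. gapsum (Tbar A) (\<lambda>v. f (incl_word A v)) (on_words L) u []) w []"
  proof (rule Tb.gapsum_cong)
    show "on_words (char_act A L f) u = gapsum (Tbar A) (\<lambda>v. f (incl_word A v)) (on_words L) u []"
      if "set u \<subseteq> set w" for u
      using sub [OF that] by (simp add: on_words_def [of "char_act A L f"] char_act_word [OF L f])
  qed (simp_all add: closed)
  also have "\<dots> = gapsum (Tbar A) (\<lambda>u. gapsum \<bbbK> (\<lambda>v. g (incl_word A v)) (\<lambda>v. f (incl_word A v)) u [])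
      (on_words L) w []"
    by (rule Tb.gapsum_gapsum) (simp_all add: closed character_incl_Nil f g)
  also have "\<dots> = gapsum (Tbar A) (\<lambda>v. convolution A f g (incl_word A v)) (on_words L) w []"
    by (rule Tb.gapsum_cong)
      (simp_all add: closed convolution_incl_word [OF f g] sub del: in_lists_conv_set)
  also have "\<dots> = char_act A L (convolution A f g) (word A w)"
    by (rule char_act_word [OF L convolution_character [OF f g] w, symmetric])
  finally show "char_act A (char_act A L f) g (word A w) =
      char_act A L (convolution A f g) (word A w)" .
qed (use assms in \<open>auto intro!: char_act_Lin convolution_character\<close>)

end

theorem proposition8p1:
  fixes A :: "('k::field_char_0, 'a) module"
  assumes "unital_assoc_algebra A"
  shows "(\<forall>x\<in>carrier (Tbar A).
            coprod A (incl A x) \<in> incl_tensor_id A ` carrier (tensor (Tbar A) (TT A))) \<and>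
         (\<forall>L\<in>Lin (Tbar A) (Tbar A). \<forall>\<Psi>\<in>carrier (character_group A).
            char_act A L \<Psi> \<in> Lin (Tbar A) (Tbar A)) \<and>
         right_action (character_group A) (Lin (Tbar A) (Tbar A)) (char_act A)"
proof -
  interpret double_tensor A
    using assms by (simp add: double_tensor_def kspace_def unital_assoc_algebra_def)
  have carrier: "carrier (character_group A) = characters A"
    and ops: "\<one>\<^bsub>character_group A\<^esub> = counit A"
      "f \<otimes>\<^bsub>character_group A\<^esub> g = convolution A f g" for f g
    by (simp_all add: character_group_def)
  show ?thesis
    unfolding right_action_def carrier ops
    using coprod_incl_in_image char_act_Lin group_character_group char_act_counit char_act_convolution
    by blast
qed

end
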